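(* Let $\Upsilon:=(0,\infty)$, $\Omega:=\Upsilon^{\mathbb N}\times\Upsilon^{\mathbb N}\times\Upsilon$ and $\Sigma:=\mathfrak B(\Omega)$. Let $\mu$ and $\rho$ be two probability measures on $\mathfrak B(\Upsilon)$ and let $h$ be a positive $\mathfrak B(\Upsilon)$-measurable function on $\Upsilon$. Then there exist: (i) a family $\{P_\theta\}_{\theta\in\Upsilon}$ of probability measures $P_\theta:=(\mathbf{Exp}(h(\theta)))^{\otimes\mathbb N}\otimes\mu^{\otimes\mathbb N}\otimes\delta_\theta$ on $\Sigma$, where $\delta_\theta$ is the Dirac measure on $\mathfrak B(\Upsilon)$ concentrated at $\theta$, and a probability measure $P$ on $\Sigma$, such that $\{P_\theta\}_{\theta\in\Upsilon}$ is a regular conditional probability of $P$ over $\rho$ consistent with $\Theta:=\pi_\Upsilon$, where $\pi_\Upsilon$ is the canonical projection from $\Omega$ onto (the last factor) $\Upsilon$, and $P_\Theta=\rho$; (ii) a counting process $N$ and a size process $X=\{X_n\}_{n\ge1}$ such that $P_{X_1}=\mu$; $P$ satisfies (a1): the interarrival process $W$ associated with $N$ and the process $X$ are $P$-conditionally independent given $\Theta$; $P$ satisfies (a2): $\Theta$ and $X$ are $P$-independent; and the pair $(N,X)$ is both a $P$-risk process and a $P_\theta$-risk process for every $\theta\in\Upsilon$, inducing an aggregate process $S$ which is a $P$-CMPP$(h(\Theta),\mu)$.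
   Context: $\mathfrak B(\cdot)$ denotes Borel $\sigma$-algebras; $\mathbf{Exp}(\lambda)$ is the exponential distribution with rate $\lambda>0$; $R_Z$ is the law of $Z$ under a measure $R$. A regular conditional probability of $P$ over $\rho$ is a family $\{P_\theta\}_{\theta\in\Upsilon}$ of probability measures on $\Sigma$ such that $\theta\mapsto P_\theta(D)$ is $\mathfrak B(\Upsilon)$-measurable and $\int P_\theta(D)\rho(d\theta)=P(D)$ for each $D\in\Sigma$. When $P_\Theta=\rho$, it is consistent with $\Theta$ if for each $B\in\mathfrak B(\Upsilon)$, $P_\theta(\Theta^{-1}(B))=1$ for $\rho$-a.a. $\theta\in B$. A counting process under a probability measure $R$ is a process $N=\{N_t\}_{t\ge0}$ with values in $\{0,1,2,\dots\}\cup\{\infty\}$ such that, outside an $R$-null set, $N_0=0$, paths are non-decreasing and right-continuous, $\sup_{s<t}N_s\le N_t\le\sup_{s<t}N_s+1$ for $t>0$, and $\sup_tN_t=\infty$. Its arrival times are $T_0=0$, $T_n=\inf\{t:N_t=n\}$ and its interarrival process is $W=\{W_n\}_{n\ge1}$, $W_n=T_n-T_{n-1}$. A size process $X=\{X_n\}_{n\ge1}$ is a sequence of positive random variables. The aggregate process induced by $(N,X)$ is $S_t=\sum_{k=1}^{N_t}X_k$, $t\ge0$. $(N,X)$ is an $R$-risk process if $N$ is a counting process under $R$, $X$ is $R$-i.i.d., and $N$ and $X$ are $R$-independent. $S$ is a $P$-CMPP$(h(\Theta),P_{X_1})$ if it is induced by a $P$-risk process $(N,X)$ such that, conditionally given $\Theta$,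 $N$ has stationary independent increments under $P$ and the conditional law of $N_t$ given $\Theta$ is Poisson with mean $th(\Theta)$ for every $t>0$. *)

theory Defs
  imports "HOL-Probability.Probability"
begin

section \<open>Conditional independence\<close>

definition cprob :: "'a measure \<Rightarrow> 'a measure \<Rightarrow> 'a set \<Rightarrow> 'a \<Rightarrow> real" where
  "cprob M F A = real_cond_exp M F (indicator A)"

text \<open>Conditional version of \<^const>\<open>prob_space.indep_sets\<close>.\<close>

definition cond_indep_sets ::
    "'a measure \<Rightarrow> 'a measure \<Rightarrow> ('i \<Rightarrow> 'a set set) \<Rightarrow> 'i set \<Rightarrow> bool" where
  "cond_indep_sets M F G I \<longleftrightarrow>
     (\<forall>i\<in>I. G i \<subseteq> sets M) \<and>
     (\<forall>J\<subseteq>I. J \<noteq> {} \<longrightarrow> finite J \<longrightarrow>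
        (\<forall>A\<in>Pi J G. AE \<omega> in M. cprob M F (\<Inter>j\<in>J. A j) \<omega> = (\<Prod>j\<in>J. cprob M F (A j) \<omega>)))"

definition cond_indep_set ::
    "'a measure \<Rightarrow> 'a measure \<Rightarrow> 'a set set \<Rightarrow> 'a set set \<Rightarrow> bool" where
  "cond_indep_set M F A B \<longleftrightarrow> cond_indep_sets M F (case_bool A B) UNIV"

definition process_events ::
    "'a measure \<Rightarrow> 'i set \<Rightarrow> 'b measure \<Rightarrow> ('i \<Rightarrow> 'a \<Rightarrow> 'b) \<Rightarrow> 'a set set" where
  "process_events M I L Z =
     sigma_sets (space M) (\<Union>i\<in>I. {Z i -` A \<inter> space M | A. A \<in> sets L})"


section \<open>Regular conditional probabilities\<close>

definition regular_cond_prob :: "('t \<Rightarrow> 'a measure) \<Rightarrow> 'a measure \<Rightarrow> 't measure \<Rightarrow> bool" where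
  "regular_cond_prob K P \<rho> \<longleftrightarrow>
     (\<forall>\<theta>\<in>space \<rho>. prob_space (K \<theta>) \<and> sets (K \<theta>) = sets P) \<and>
     (\<forall>D\<in>sets P. (\<lambda>\<theta>. emeasure (K \<theta>) D) \<in> borel_measurable \<rho> \<and>
        (\<integral>\<^sup>+\<theta>. emeasure (K \<theta>) D \<partial>\<rho>) = emeasure P D)"

definition consistent_with ::
    "('t \<Rightarrow> 'a measure) \<Rightarrow> 'a measure \<Rightarrow> 't measure \<Rightarrow> ('a \<Rightarrow> 't) \<Rightarrow> bool" where
  "consistent_with K P \<rho> \<Theta> \<longleftrightarrow>
     (\<forall>B\<in>sets \<rho>. AE \<theta> in \<rho>. \<theta> \<in> B \<longrightarrow> emeasure (K \<theta>) (\<Theta> -` B \<inter> space P) = 1)"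


section \<open>Risk processes\<close>

text \<open>The half-line \<open>(0, \<infinity>)\<close> with its Borel sets. The measure carried by this object is irrelevant;
  it is only used as a measurable space.\<close>

definition Ups :: "real measure" where
  "Ups = restrict_space borel {0<..}"

text \<open>Processes indexed by time are functions on \<^typ>\<open>real\<close> that are only inspected at \<open>t \<ge> 0\<close>;
  sequences indexed by \<open>n \<ge> 1\<close> are functions on \<^typ>\<open>nat\<close> that are only inspected on \<open>{1..}\<close>.
  The topology of \<^typ>\<open>enat\<close> is the order topology, and its Borel sets are all subsets.\<close>

definition counting_process :: "'a measure \<Rightarrow> (real \<Rightarrow> 'a \<Rightarrow> enat) \<Rightarrow> bool" where
  "counting_process R N \<longleftrightarrow>
     (\<forall>t\<ge>0. N t \<in> measurable R (count_space UNIV)) \<and>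
     (AE \<omega> in R.
        N 0 \<omega> = 0 \<and>
        (\<forall>s t. 0 \<le> s \<longrightarrow> s \<le> t \<longrightarrow> N s \<omega> \<le> N t \<omega>) \<and>
        (\<forall>t\<ge>0. ((\<lambda>s. N s \<omega>) \<longlongrightarrow> N t \<omega>) (at_right t)) \<and>
        (\<forall>t>0. (SUP s\<in>{0..<t}. N s \<omega>) \<le> N t \<omega> \<and> N t \<omega> \<le> (SUP s\<in>{0..<t}. N s \<omega>) + 1) \<and>
        (SUP t\<in>{0..}. N t \<omega>) = \<infinity>)"

text \<open>Extended-real valued, so that the infimum of the empty set is \<open>\<infinity>\<close>; outside the null
  set excluded for a counting process all values are finite.\<close>

definition arrival :: "(real \<Rightarrow> 'a \<Rightarrow> enat) \<Rightarrow> nat \<Rightarrow> 'a \<Rightarrow> ereal" where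
  "arrival N n \<omega> = (if n = 0 then 0 else Inf {ereal t | t. 0 \<le> t \<and> N t \<omega> = enat n})"

definition interarrival :: "(real \<Rightarrow> 'a \<Rightarrow> enat) \<Rightarrow> nat \<Rightarrow> 'a \<Rightarrow> ereal" where
  "interarrival N n \<omega> = arrival N n \<omega> - arrival N (n - 1) \<omega>"

definition size_process :: "'a measure \<Rightarrow> (nat \<Rightarrow> 'a \<Rightarrow> real) \<Rightarrow> bool" where
  "size_process R X \<longleftrightarrow> (\<forall>n\<ge>1. X n \<in> measurable R Ups)"

text \<open>\<open>\<Sum>\<^sub>k X\<^sub>k\<close> over \<open>1 \<le> k \<le> N\<^sub>t\<close>, an infinite series when \<open>N\<^sub>t = \<infinity>\<close>.\<close>

definition aggregate ::
    "(real \<Rightarrow> 'a \<Rightarrow> enat) \<Rightarrow> (nat \<Rightarrow> 'a \<Rightarrow> real) \<Rightarrow> real \<Rightarrow> 'a \<Rightarrow> ennreal" where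
  "aggregate N X t \<omega> = (\<Sum>k. if 1 \<le> k \<and> enat k \<le> N t \<omega> then ennreal (X k \<omega>) else 0)"

definition risk_process ::
    "'a measure \<Rightarrow> (real \<Rightarrow> 'a \<Rightarrow> enat) \<Rightarrow> (nat \<Rightarrow> 'a \<Rightarrow> real) \<Rightarrow> bool" where
  "risk_process R N X \<longleftrightarrow>
     prob_space R \<and> counting_process R N \<and> size_process R X \<and>
     prob_space.indep_vars R (\<lambda>_. Ups) X {1..} \<and>
     (\<forall>n\<ge>1. distr R Ups (X n) = distr R Ups (X 1)) \<and>
     prob_space.indep_set R
       (process_events R {0..} (count_space UNIV) N) (process_events R {1..} Ups X)"

text \<open>Subtraction on \<^typ>\<open>enat\<close> is total and truncated, but under the laws below \<open>N\<close> is almost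
  surely non-decreasing and finite at every time, so these are genuine increments.\<close>

definition cond_stationary_indep_increments ::
    "'a measure \<Rightarrow> 'a measure \<Rightarrow> (real \<Rightarrow> 'a \<Rightarrow> enat) \<Rightarrow> bool" where
  "cond_stationary_indep_increments M F N \<longleftrightarrow>
     (\<forall>(m::nat) (t :: nat \<Rightarrow> real). 0 \<le> t 0 \<longrightarrow> (\<forall>j<m. t j < t (Suc j)) \<longrightarrow>
        cond_indep_sets M F
          (\<lambda>j. {(\<lambda>\<omega>. N (t (Suc j)) \<omega> - N (t j) \<omega>) -` B \<inter> space M | B. True}) {..<m}) \<and>
     (\<forall>s t u B. 0 \<le> s \<longrightarrow> s < t \<longrightarrow> 0 \<le> u \<longrightarrow>
        (AE \<omega> in M.
           cprob M F ((\<lambda>\<omega>. N (t + u) \<omega> - N (s + u) \<omega>) -` B \<inter> space M) \<omega> =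
           cprob M F ((\<lambda>\<omega>. N t \<omega> - N s \<omega>) -` B \<inter> space M) \<omega>))"

text \<open>\<open>S\<close>, induced by \<open>(N, X)\<close>, is an \<open>M\<close>-CMPP\<open>(h(\<Theta>), \<nu>)\<close>. The inducing pair is an explicit
  argument. Conditioning on \<open>\<Theta>\<close> is conditioning on the sigma-algebra generated by \<open>\<Theta>\<close>.\<close>

definition CMPP ::
    "'a measure \<Rightarrow> (real \<Rightarrow> real) \<Rightarrow> ('a \<Rightarrow> real) \<Rightarrow> real measure \<Rightarrow>
     (real \<Rightarrow> 'a \<Rightarrow> enat) \<Rightarrow> (nat \<Rightarrow> 'a \<Rightarrow> real) \<Rightarrow> (real \<Rightarrow> 'a \<Rightarrow> ennreal) \<Rightarrow> bool" where
  "CMPP M h \<Theta> \<nu> N X S \<longleftrightarrow>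
     \<Theta> \<in> measurable M Ups \<and>
     risk_process M N X \<and>
     distr M Ups (X 1) = \<nu> \<and>
     (\<forall>t\<ge>0. \<forall>\<omega>\<in>space M. S t \<omega> = aggregate N X t \<omega>) \<and>
     cond_stationary_indep_increments M (vimage_algebra (space M) \<Theta> Ups) N \<and>
     (\<forall>t>0. \<forall>B. AE \<omega> in M.
        cprob M (vimage_algebra (space M) \<Theta> Ups) (N t -` B \<inter> space M) \<omega> =
        measure_pmf.prob (poisson_pmf (t * h (\<Theta> \<omega>))) (enat -` B))"


section \<open>The canonical space\<close>

type_synonym path = "(nat \<Rightarrow> real) \<times> (nat \<Rightarrow> real) \<times> real"

definition Omega :: "path set" where
  "Omega = (UNIV \<rightarrow> {0<..}) \<times> (UNIV \<rightarrow> {0<..}) \<times> {0<..}"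

text \<open>\<^const>\<open>borel\<close> on \<^typ>\<open>path\<close> is generated by the product topology, so this is the Borel
  sigma-algebra of the subspace \<^term>\<open>Omega\<close>.\<close>

definition Sig :: "path measure" where
  "Sig = restrict_space borel Omega"

definition proj_Theta :: "path \<Rightarrow> real" where
  "proj_Theta = (\<lambda>(w, x, \<theta>). \<theta>)"

definition Exp_law :: "real \<Rightarrow> real measure" where
  "Exp_law l = restrict_space (density lborel (exponential_density l)) {0<..}"

definition P_kernel :: "(real \<Rightarrow> real) \<Rightarrow> real measure \<Rightarrow> real \<Rightarrow> path measure" where
  "P_kernel h \<mu> \<theta> =
     (\<Pi>\<^sub>M n\<in>(UNIV::nat set). Exp_law (h \<theta>)) \<Otimes>\<^sub>M ((\<Pi>\<^sub>M n\<in>(UNIV::nat set). \<mu>) \<Otimes>\<^sub>M return Ups \<theta>)"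

end

theory Submission
  imports Defs
begin

text \<open>
  On the canonical space let \<open>N\<^sub>t\<close> count the partial sums of the first coordinate that are at most
  \<open>t\<close>, let \<open>X\<close> be the second coordinate, and let \<open>P\<close> be the mixture of the kernel over \<open>\<rho>\<close>. Since all
  entries of the first coordinate are positive, the interarrival times of \<open>N\<close> are exactly these
  entries.

  The exponential law is memoryless: given that \<open>n\<close> arrivals occurred up to \<open>t\<close>, the interarrival
  times seen from \<open>t\<close> on are again independent and exponential, whatever happened before. This is
  proved by induction on \<open>n\<close>, by conditioning on the first arrival, and it yields the Poisson law of
  \<open>N\<^sub>t\<close>, the almost sure finiteness of \<open>N\<^sub>t\<close> and, by induction on the number of time points, the
  independent stationary increments.

  As the last coordinate is \<open>P\<^sub>\<theta>\<close>-almost surely equal to \<open>\<theta>\<close>, the conditional probability of an event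
  \<open>D\<close> under \<open>P\<close> given \<open>\<Theta>\<close> is \<open>P\<^sub>\<Theta> D\<close>. Hence independence under every \<open>P\<^sub>\<theta>\<close> becomes conditional
  independence under \<open>P\<close>.
\<close>

section \<open>Counting the partial sums of a positive sequence\<close>

definition cnt :: "real \<Rightarrow> (nat \<Rightarrow> real) \<Rightarrow> enat" where
  "cnt t w = (SUP n\<in>{n. sum w {..<n} \<le> t}. enat n)"

lemma strict_mono_psum:
  fixes w :: "nat \<Rightarrow> real"
  assumes w: "\<forall>k. 0 < w k"
  shows "strict_mono (\<lambda>n. sum w {..<n})"
  using assms by (intro strict_monoI_Suc) simp

text \<open>Partial sums increase, so the admissible \<open>n\<close> form an initial segment, and a
  supremum above \<open>k\<close> provides an admissible \<open>m > k\<close>. This turns questions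
  about \<open>cnt\<close> into inequalities between partial sums.\<close>

lemma enat_le_cnt_iff:
  assumes w: "\<forall>k. 0 < w k" and t: "0 \<le> t"
  shows "enat n \<le> cnt t w \<longleftrightarrow> sum w {..<n} \<le> t"
proof
  assume "sum w {..<n} \<le> t"
  then show "enat n \<le> cnt t w"
    unfolding cnt_def by (intro SUP_upper) simp
next
  assume n: "enat n \<le> cnt t w"
  show "sum w {..<n} \<le> t"
  proof (cases n)
    case 0
    with t show ?thesis by simp
  next
    case (Suc k)
    with n have "enat k < cnt t w"
      by (metis Suc_ile_eq)
    then obtain m where "sum w {..<m} \<le> t" "k < m"
      unfolding cnt_def less_SUP_iff by auto
    moreover have "sum w {..<n} \<le> sum w {..<m}"
      using monoD[OF strict_mono_mono[OF strict_mono_psum[OF w]], of n m] \<open>k < m\<close> Suc by simp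
    ultimately show ?thesis by simp
  qed
qed

text \<open>An element of \<open>enat\<close>, \<open>\<infinity>\<close> included, is determined by
  the finite numbers below it; with \<open>enat_le_cnt_iff\<close> this gives equality of possibly
  infinite counts.\<close>

lemma enat_eqI_le:
  assumes "\<And>k. enat k \<le> a \<longleftrightarrow> enat k \<le> b"
  shows "a = b"
proof (rule antisym)
  show "a \<le> b"
    using assms by (cases a; cases b) (auto, metis Suc_n_not_le_n enat_ord_simps(1) nat_le_linear)
  show "b \<le> a"
    using assms by (cases a; cases b) (auto, metis Suc_n_not_le_n enat_ord_simps(1) nat_le_linear)
qed

lemma enat_eq_iff_le: "x = enat n \<longleftrightarrow> enat n \<le> x \<and> \<not> enat (Suc n) \<le> x"
  by (cases x) auto

lemma cnt_eq_iff:
  assumes "\<forall>k. 0 < w k" "0 \<le> t"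
  shows "cnt t w = enat n \<longleftrightarrow> sum w {..<n} \<le> t \<and> t < sum w {..<Suc n}"
  unfolding enat_eq_iff_le enat_le_cnt_iff[OF assms] by auto

text \<open>The interarrival times seen from time \<open>t\<close> on, provided that exactly \<open>n\<close> arrivals occurred up
  to \<open>t\<close>. Otherwise the first entry could be negative; the junk value 1 keeps the sequence
  positive.\<close>

definition restart :: "nat \<Rightarrow> real \<Rightarrow> (nat \<Rightarrow> real) \<Rightarrow> nat \<Rightarrow> real" where
  "restart n t w k =
     (if k = 0 then if t < sum w {..<Suc n} then sum w {..<Suc n} - t else 1 else w (n + k))"

lemma restart_pos: "\<forall>k. 0 < w k \<Longrightarrow> 0 < restart n t w k"
  by (simp add: restart_def)

text \<open>The new first entry accounts for all of \<open>w\<close> up to the next arrival, less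
  the elapsed time \<open>t\<close>; every later entry is copied from \<open>w\<close>.\<close>

lemma sum_restart:
  "t < sum w {..<Suc n} \<Longrightarrow> sum (restart n t w) {..<Suc k} = sum w {..<Suc (n + k)} - t"
  by (induction k) (simp_all add: restart_def)

text \<open>The sides are compared through their finite lower bounds \<open>k\<close>. For
  \<open>k \<le> n\<close> both inequalities hold; for \<open>k > n\<close> the partial sums of the
  two sequences differ by exactly \<open>t\<close>, which cancels the shift of time.\<close>

lemma cnt_add:
  assumes w: "\<forall>k. 0 < w k" and t: "0 \<le> t" and n: "cnt t w = enat n" and s: "0 \<le> s"
  shows "cnt (t + s) w = enat n + cnt s (restart n t w)"
proof (rule enat_eqI_le)
  fix k
  have pos: "\<forall>k. 0 < restart n t w k"
    using restart_pos[OF w] by blast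
  have le: "sum w {..<n} \<le> t" and less: "t < sum w {..<Suc n}"
    using n unfolding cnt_eq_iff[OF w t] by auto
  have *: "enat k \<le> enat n + a \<longleftrightarrow> enat (k - n) \<le> a" for a
    by (cases a) auto
  show "enat k \<le> cnt (t + s) w \<longleftrightarrow> enat k \<le> enat n + cnt s (restart n t w)"
  proof (cases "k \<le> n")
    case True
    then have "sum w {..<k} \<le> sum w {..<n}"
      using monoD[OF strict_mono_mono[OF strict_mono_psum[OF w]]] by simp
    with True le t s show ?thesis
      by (simp add: * enat_le_cnt_iff[OF w] zero_enat_def[symmetric])
  next
    case False
    \<comment> \<open>Since \<open>k\<close> exceeds \<open>n\<close> by \<open>Suc j\<close>, the
      restarted sequence contributes a nonempty partial sum, as \<open>sum_restart\<close>
      requires.\<close>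
    then obtain j where j: "k = Suc (n + j)"
      by (metis add_Suc_right less_imp_Suc_add not_le)
    then have "enat k \<le> enat n + cnt s (restart n t w) \<longleftrightarrow> enat (Suc j) \<le> cnt s (restart n t w)"
      by (subst *) simp
    also have "\<dots> \<longleftrightarrow> sum w {..<k} - t \<le> s"
      unfolding enat_le_cnt_iff[OF pos s] sum_restart[OF less] j ..
    also have "\<dots> \<longleftrightarrow> sum w {..<k} \<le> t + s"
      by linarith
    also have "\<dots> \<longleftrightarrow> enat k \<le> cnt (t + s) w"
      using t s by (intro enat_le_cnt_iff[symmetric, OF w]) simp
    finally show ?thesis ..
  qed
qed

section \<open>Path properties of the counting function\<close>

lemma cnt_mono: "s \<le> t \<Longrightarrow> cnt s w \<le> cnt t w"
  unfolding cnt_def by (rule SUP_subset_mono) auto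

lemma cnt_0: "\<forall>k. 0 < w k \<Longrightarrow> cnt 0 w = 0"
  unfolding zero_enat_def by (subst cnt_eq_iff) simp_all

text \<open>A finite count \<open>n\<close> leaves a gap between \<open>t\<close> and the next
  partial sum \<open>sum w {..<Suc n}\<close>, and the path is constant on this gap.\<close>

lemma tendsto_cnt_at_right:
  assumes w: "\<forall>k. 0 < w k" and t: "0 \<le> t" and fin: "cnt t w \<noteq> \<infinity>"
  shows "((\<lambda>s. cnt s w) \<longlongrightarrow> cnt t w) (at_right t)"
proof (rule tendsto_eventually)
  obtain n where n: "cnt t w = enat n"
    using fin by auto
  then have "sum w {..<n} \<le> t" "t < sum w {..<Suc n}"
    by (simp_all add: cnt_eq_iff[OF w t])
  then show "\<forall>\<^sub>F s in at_right t. cnt s w = cnt t w"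
    using t by (intro eventually_at_rightI[of t "sum w {..<Suc n}"]) (simp_all add: n cnt_eq_iff[OF w])
qed

text \<open>If the count at \<open>t\<close> is \<open>Suc k\<close>, then
  \<open>sum w {..<k}\<close> is strictly less than \<open>t\<close> because \<open>w k\<close> is
  positive, so at least \<open>k\<close> arrivals are seen before \<open>t\<close>.\<close>

lemma cnt_le_SUP_plus_1:
  assumes w: "\<forall>k. 0 < w k" and t: "0 < t" and fin: "cnt t w \<noteq> \<infinity>"
  shows "cnt t w \<le> (SUP s\<in>{0..<t}. cnt s w) + 1"
proof -
  obtain n where n: "cnt t w = enat n"
    using fin by auto
  show ?thesis
  proof (cases n)
    case 0
    with n show ?thesis by (simp add: zero_enat_def[symmetric])
  next
    case (Suc k)
    let ?s = "sum w {..<k}"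
    have "0 \<le> ?s"
      using w by (intro sum_nonneg less_imp_le) blast
    moreover have "?s < t"
      using n[unfolded Suc cnt_eq_iff[OF w less_imp_le[OF t]]] w[rule_format, of k] by simp
    ultimately have s: "0 \<le> ?s" "?s < t"
      by blast+
    have "enat k \<le> cnt ?s w"
      using s enat_le_cnt_iff[OF w] by simp
    also have "\<dots> \<le> (SUP s\<in>{0..<t}. cnt s w)"
      using s by (intro SUP_upper) auto
    finally have "enat k + 1 \<le> (SUP s\<in>{0..<t}. cnt s w) + 1"
      by (rule add_right_mono)
    then show ?thesis
      by (simp add: n Suc one_enat_def)
  qed
qed

lemma SUP_cnt:
  assumes w: "\<forall>k. 0 < w k"
  shows "(SUP t\<in>{0..}. cnt t w) = \<infinity>"
proof -
  have "enat n \<le> (SUP t\<in>{0..}. cnt t w)" for n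
  proof -
    have "0 \<le> sum w {..<n}"
      using w by (intro sum_nonneg less_imp_le) blast
    then show ?thesis
      using enat_le_cnt_iff[OF w] by (intro SUP_upper2[of "sum w {..<n}"]) auto
  qed
  then show ?thesis
    by (metis Suc_ile_eq enat_ord_simps(4) not_enat_eq order_less_irrefl)
qed

text \<open>Level \<open>n\<close> is attained at the \<open>n\<close>-th partial sum itself, as the
  next entry is positive, and a count of \<open>n\<close> forces that much time to have passed.
  Hence the arrival times are the partial sums.\<close>

lemma Inf_cnt_eq:
  assumes w: "\<forall>k. 0 < w k"
  shows "Inf {ereal t | t. 0 \<le> t \<and> cnt t w = enat n} = ereal (sum w {..<n})"
proof (rule antisym)
  have s: "0 \<le> sum w {..<n}"
    using w by (intro sum_nonneg less_imp_le) blast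
  have "cnt (sum w {..<n}) w = enat n"
    unfolding cnt_eq_iff[OF w s] using w by simp
  with s show "Inf {ereal t | t. 0 \<le> t \<and> cnt t w = enat n} \<le> ereal (sum w {..<n})"
    by (intro Inf_lower) blast
  show "ereal (sum w {..<n}) \<le> Inf {ereal t | t. 0 \<le> t \<and> cnt t w = enat n}"
  proof (rule Inf_greatest)
    fix x assume "x \<in> {ereal t | t. 0 \<le> t \<and> cnt t w = enat n}"
    then obtain t where "x = ereal t" "0 \<le> t" "cnt t w = enat n"
      by blast
    then show "ereal (sum w {..<n}) \<le> x"
      using cnt_eq_iff[OF w, of t n] by simp
  qed
qed

section \<open>Independent exponential interarrival times\<close>

lemma space_Ups: "space Ups = {0<..}"
  by (simp add: Ups_def space_restrict_space)

lemma measurable_Ups_borel: "(\<lambda>x. x) \<in> borel_measurable Ups"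
  unfolding Ups_def by (intro measurable_restrict_space1) simp

lemma measurable_UpsI:
  "f \<in> borel_measurable M \<Longrightarrow> (\<And>x. x \<in> space M \<Longrightarrow> 0 < f x) \<Longrightarrow> f \<in> measurable M Ups"
  unfolding Ups_def by (intro measurable_restrict_space2) auto

lemma sets_Exp_law: "sets (Exp_law l) = sets Ups"
  unfolding Exp_law_def Ups_def by (rule sets_restrict_space_cong) simp

lemma space_Exp_law: "space (Exp_law l) = {0<..}"
  using sets_eq_imp_space_eq[OF sets_Exp_law] by (simp add: space_Ups)

text \<open>Moves integration from the half-line to the real line, where translation of Lebesgue
  measure and the fundamental theorem of calculus are available.\<close>

lemma nn_integral_Exp_law:
  assumes "f \<in> borel_measurable Ups"
  shows "(\<integral>\<^sup>+x. f x \<partial>Exp_law l) =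
    (\<integral>\<^sup>+x. ennreal (l * exp (- l * x)) * (f x * indicator {0<..} x) \<partial>lborel)"
proof -
  have "(\<lambda>x. f x * indicator {0<..} x) \<in> borel_measurable borel"
    using assms unfolding Ups_def by (subst (asm) borel_measurable_restrict_space_iff_ennreal) auto
  then have "(\<integral>\<^sup>+x. f x \<partial>Exp_law l) =
      (\<integral>\<^sup>+x. ennreal (exponential_density l x) * (f x * indicator {0<..} x) \<partial>lborel)"
    unfolding Exp_law_def by (subst nn_integral_restrict_space) (simp_all add: nn_integral_density)
  also have "\<dots> = (\<integral>\<^sup>+x. ennreal (l * exp (- l * x)) * (f x * indicator {0<..} x) \<partial>lborel)"
    by (intro nn_integral_cong) (auto simp: exponential_density_def indicator_def mult.commute)
  finally show ?thesis .
qed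

text \<open>The exponential density vanishes on the negative axis and the point 0 is a Lebesgue null
  set, so restricting to the open half-line loses no mass.\<close>

lemma prob_space_Exp_law:
  assumes "0 < l"
  shows "prob_space (Exp_law l)"
  unfolding Exp_law_def
proof (rule prob_space_restrict_space)
  let ?D = "density lborel (exponential_density l)"
  interpret prob_space ?D
    using assms by (rule prob_space_exponential_density)
  have "AE x in ?D. x \<in> {0<..}"
    using AE_lborel_singleton[of 0]
    by (auto simp: AE_density exponential_density_def elim!: eventually_mono)
  then show "emeasure ?D {0<..} = 1"
    by (intro emeasure_eq_1_AE) simp_all
qed simp

section \<open>The space of positive sequences\<close>

abbreviation Seq :: "(nat \<Rightarrow> real) measure" where
  "Seq \<equiv> \<Pi>\<^sub>M n\<in>UNIV. Ups"

abbreviation Exp_seq :: "real \<Rightarrow> (nat \<Rightarrow> real) measure" where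
  "Exp_seq l \<equiv> \<Pi>\<^sub>M n\<in>UNIV. Exp_law l"

lemma sets_Exp_seq: "sets (Exp_seq l) = sets Seq"
  by (intro sets_PiM_cong sets_Exp_law refl)

lemma space_Seq: "space Seq = {w. \<forall>k. 0 < w k}"
  by (auto simp: space_PiM space_Ups)

lemma space_Exp_seq: "space (Exp_seq l) = {w. \<forall>k. 0 < w k}"
  by (auto simp: space_PiM space_Exp_law)

lemma measurable_Seq_component [measurable]: "(\<lambda>w. w k) \<in> borel_measurable Seq"
  using measurable_compose[OF measurable_component_singleton[of k UNIV "\<lambda>_. Ups"],
      where g="\<lambda>x. x"] measurable_Ups_borel by simp

text \<open>Each finite level is cut out by two inequalities on partial sums, and the infinite level
  is the complement of these countably many sets. Singletons suffice because \<open>enat\<close> is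
  countable.\<close>

lemma measurable_cnt:
  assumes "0 \<le> t"
  shows "cnt t \<in> measurable Seq (count_space UNIV)"
proof -
  have *: "cnt t -` {enat n} \<inter> space Seq \<in> sets Seq" for n
  proof -
    have "cnt t -` {enat n} \<inter> space Seq = {w\<in>space Seq. sum w {..<n} \<le> t \<and> t < sum w {..<Suc n}}"
      using assms by (auto simp: space_Seq cnt_eq_iff simp del: sum.lessThan_Suc)
    also have "\<dots> \<in> sets Seq"
      by measurable
    finally show ?thesis .
  qed
  have "cnt t -` {\<infinity>} \<inter> space Seq = space Seq - (\<Union>n. cnt t -` {enat n} \<inter> space Seq)"
    by auto
  also have "\<dots> \<in> sets Seq"
    using * by (intro sets.Diff sets.top sets.countable_UN) auto
  finally have "cnt t -` {a} \<inter> space Seq \<in> sets Seq" for a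
    using * by (cases a) auto
  then show ?thesis
    by (subst measurable_count_space_eq_countable) auto
qed

lemma measurable_restart: "restart n t \<in> measurable Seq Seq"
proof (rule measurable_PiM_single')
  fix k
  have "(\<lambda>w. restart n t w k) \<in> borel_measurable Seq"
    unfolding restart_def by measurable
  then show "(\<lambda>w. restart n t w k) \<in> measurable Seq Ups"
    by (rule measurable_UpsI) (simp add: space_Seq restart_pos)
qed (auto simp: space_Seq space_Ups restart_pos)

section \<open>Splitting off the first arrival\<close>

lemma sum_case_nat: "sum (case_nat s w) {..<Suc n} = s + sum w {..<n}"
  unfolding sum.lessThan_Suc_shift by simp

lemma cnt_case_nat_eq_0_iff:
  assumes w: "\<forall>k. 0 < w k" and "0 < s" "0 \<le> t"
  shows "cnt t (case_nat s w) = enat 0 \<longleftrightarrow> t < s"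
proof -
  have "\<forall>k. 0 < case_nat s w k"
    using assms by (simp split: nat.split)
  from cnt_eq_iff[OF this \<open>0 \<le> t\<close>, of 0] show ?thesis
    using assms by simp
qed

text \<open>After the first arrival at \<open>s\<close>, the remaining entries are counted over the
  remaining time \<open>t - s\<close>. The guard \<open>s \<le> t\<close> matters for
  \<open>n = 0\<close>, because the count is 0 at negative times.\<close>

lemma cnt_case_nat_eq_Suc_iff:
  assumes w: "\<forall>k. 0 < w k" and "0 < s" "0 \<le> t"
  shows "cnt t (case_nat s w) = enat (Suc n) \<longleftrightarrow> s \<le> t \<and> cnt (t - s) w = enat n"
proof -
  have "\<forall>k. 0 < case_nat s w k"
    using assms by (simp split: nat.split)
  from cnt_eq_iff[OF this \<open>0 \<le> t\<close>, of "Suc n"]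
  have *: "cnt t (case_nat s w) = enat (Suc n) \<longleftrightarrow> s + sum w {..<n} \<le> t \<and> t < s + sum w {..<Suc n}"
    unfolding sum_case_nat .
  have "0 \<le> sum w {..<n}"
    using w by (intro sum_nonneg less_imp_le) blast
  then show ?thesis
    using cnt_eq_iff[OF w, of "t - s" n] unfolding * by (cases "s \<le> t") auto
qed

lemma restart_0_case_nat: "t < s \<Longrightarrow> restart 0 t (case_nat s w) = case_nat (s - t) w"
  by (auto simp: restart_def split: nat.split)

text \<open>Discarding the first arrival lowers both the number of arrivals and the elapsed time,
  and the residual waiting time is unchanged. This is what makes an induction on \<open>n\<close>
  possible.\<close>

lemma restart_Suc_case_nat: "restart (Suc n) t (case_nat s w) = restart n (t - s) w"
  unfolding restart_def sum_case_nat by (auto simp: fun_eq_iff algebra_simps)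

text \<open>The integrand describes a first arrival at \<open>s\<close> followed by \<open>n\<close>
  more within \<open>t - s\<close>. The two exponentials multiply to the constant
  \<open>exp (- l * t)\<close>, so only a power of \<open>t - s\<close> remains to be
  integrated.\<close>

lemma nn_integral_Erlang:
  fixes l t :: real
  assumes "0 < l" "0 \<le> t"
  shows "(\<integral>\<^sup>+s. ennreal (l * exp (- l * s) * ((l * (t - s)) ^ n / fact n * exp (- l * (t - s)))) *
      indicator {0<..t} s \<partial>lborel) = ennreal ((l * t) ^ Suc n / fact (Suc n) * exp (- l * t))"
proof -
  let ?f = "\<lambda>s. l * exp (- l * t) * ((l * (t - s)) ^ n / fact n)"
  let ?F = "\<lambda>s. - (exp (- l * t) * ((l * (t - s)) ^ Suc n / fact (Suc n)))"
  have *: "exp (- l * s) * exp (- l * (t - s)) = exp (- l * t)" for s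
    by (simp add: exp_add[symmetric] algebra_simps)
  have "l * exp (- l * s) * ((l * (t - s)) ^ n / fact n * exp (- l * (t - s))) = ?f s" for s
    unfolding *[of s, symmetric] by (simp only: ac_simps times_divide_eq_right times_divide_eq_left)
  then have "(\<integral>\<^sup>+s. ennreal (l * exp (- l * s) * ((l * (t - s)) ^ n / fact n * exp (- l * (t - s)))) *
      indicator {0<..t} s \<partial>lborel) = (\<integral>\<^sup>+s. ennreal (?f s) * indicator {0<..t} s \<partial>lborel)"
    by (simp only:)
  \<comment> \<open>The added endpoint 0 is a null set; the fundamental theorem is applied on a
    closed interval.\<close>
  also have "\<dots> = (\<integral>\<^sup>+s. ennreal (?f s) * indicator {0..t} s \<partial>lborel)"
    using AE_lborel_singleton[of 0]
    by (intro nn_integral_cong_AE) (auto simp: indicator_def elim!: eventually_mono)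
  also have "\<dots> = ennreal (?F t - ?F 0)"
  proof (rule nn_integral_FTC_Icc)
    fix s assume s: "s \<in> {0..t}"
    show "0 \<le> ?f s"
      using s assms by simp
    have "((\<lambda>s. (l * (t - s)) ^ Suc n) has_real_derivative
        (real (Suc n) * (l * (t - s)) ^ (Suc n - Suc 0)) * (- l)) (at s)"
      by (rule DERIV_chain2[OF DERIV_pow]) (auto intro!: derivative_eq_intros)
    from DERIV_minus[OF DERIV_cmult[OF DERIV_cdivide[OF this], of "exp (- l * t)" "fact (Suc n)"]]
    show "(?F has_real_derivative ?f s) (at s)"
      by (rule DERIV_cong) (simp add: divide_simps del: of_nat_Suc)
  qed (use assms in auto)
  \<comment> \<open>\<open>?F t\<close> vanishes, as it contains a positive power of
    \<open>t - t\<close>.\<close>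
  also have "?F t - ?F 0 = (l * t) ^ Suc n / fact (Suc n) * exp (- l * t)"
    by (simp del: fact_Suc)
  finally show ?thesis .
qed


lemma measurable_restart_on_cnt:
  assumes "0 \<le> t" "g \<in> borel_measurable Seq"
  shows "(\<lambda>w. indicator {enat n} (cnt t w) * g (restart n t w) :: ennreal) \<in> borel_measurable Seq"
  by (intro borel_measurable_times_ennreal measurable_compose[OF measurable_cnt[OF assms(1)]]
      measurable_compose[OF measurable_restart assms(2)]) simp

lemma sets_cnt: "0 \<le> t \<Longrightarrow> {w \<in> space Seq. cnt t w \<in> A} \<in> sets Seq"
  using measurable_sets[OF measurable_cnt, of t A] by (simp add: vimage_def Int_def conj_commute)

lemma sets_cnt_Exp_seq: "0 \<le> t \<Longrightarrow> {w \<in> space (Exp_seq l). cnt t w \<in> A} \<in> sets (Exp_seq l)"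
  using sets_cnt by (simp add: sets_Exp_seq space_Exp_seq space_Seq)

text \<open>Increments after \<open>t\<close> are increments of the restarted sequence: by
  \<open>cnt_add\<close> the two counts share the finite summand \<open>cnt t w\<close>, which
  cancels in the subtraction even if a later count is \<open>\<infinity>\<close>.\<close>

lemma cnt_diff_restart:
  assumes w: "\<forall>k. 0 < w k" and "0 \<le> t" "t \<le> a" "t \<le> b" "cnt t w \<noteq> \<infinity>"
  shows "cnt a w - cnt b w =
    cnt (a - t) (restart (the_enat (cnt t w)) t w) - cnt (b - t) (restart (the_enat (cnt t w)) t w)"
proof -
  obtain n where n: "cnt t w = enat n"
    using assms by auto
  have "cnt a w = enat n + cnt (a - t) (restart n t w)" "cnt b w = enat n + cnt (b - t) (restart n t w)"
    using cnt_add[OF w \<open>0 \<le> t\<close> n, of "a - t"] cnt_add[OF w \<open>0 \<le> t\<close> n, of "b - t"] assms by simp_all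
  moreover have "enat n + x - (enat n + y) = x - y" for x y
    by (cases x; cases y) simp_all
  ultimately show ?thesis
    by (simp add: n)
qed

lemma measurable_cnt_diff:
  assumes "0 \<le> a" "0 \<le> b"
  shows "(\<lambda>w. cnt a w - cnt b w) \<in> measurable Seq (count_space UNIV)"
proof (rule measurable_compose_countable[OF _ measurable_cnt[OF assms(2)]])
  fix i
  show "(\<lambda>w. cnt a w - i) \<in> measurable Seq (count_space UNIV)"
    by (rule measurable_compose[OF measurable_cnt[OF assms(1)]]) simp
qed

text \<open>Positivity is part of the event, so that it is a subset of the underlying space of
  sequences.\<close>

definition incr_event :: "nat \<Rightarrow> (nat \<Rightarrow> real) \<Rightarrow> (nat \<Rightarrow> enat set) \<Rightarrow> (nat \<Rightarrow> real) set" where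
  "incr_event m t A = {w. (\<forall>k. 0 < w k) \<and> (\<forall>j<m. cnt (t (Suc j)) w - cnt (t j) w \<in> A j)}"

lemma sets_incr_event:
  assumes "\<And>j. j \<le> m \<Longrightarrow> 0 \<le> t j"
  shows "incr_event m t A \<in> sets Seq"
proof -
  have *: "{w \<in> space Seq. cnt (t (Suc j)) w - cnt (t j) w \<in> A j} \<in> sets Seq" if "j < m" for j
    using measurable_sets[OF measurable_cnt_diff, of "t (Suc j)" "t j" "A j"] assms that
    by (simp add: vimage_def Int_def conj_commute)
  have "incr_event m t A = {w \<in> space Seq. \<forall>j\<in>{..<m}. cnt (t (Suc j)) w - cnt (t j) w \<in> A j}"
    by (auto simp: incr_event_def space_Seq)
  also have "\<dots> \<in> sets Seq"
    using * by (intro sets.sets_Collect_finite_All) auto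
  finally show ?thesis .
qed

lemma sets_cnt_diff:
  "0 \<le> a \<Longrightarrow> 0 \<le> b \<Longrightarrow> {w \<in> space Seq. cnt a w - cnt b w \<in> B} \<in> sets Seq"
  using measurable_sets[OF measurable_cnt_diff, of a b B] by (simp add: vimage_def Int_def conj_commute)

section \<open>Memorylessness of independent exponential interarrival times\<close>

context
  fixes l :: real
  assumes l: "0 < l"
begin

lemma sequence_space_Exp_law: "sequence_space (Exp_law l)"
proof -
  interpret prob_space "Exp_law l"
    by (rule prob_space_Exp_law[OF l])
  show ?thesis
    unfolding sequence_space_def product_prob_space_def product_prob_space_axioms_def
      product_sigma_finite_def
    by (auto intro: sigma_finite_measure_axioms prob_space_axioms)
qed

text \<open>Prepending an independent exponential entry to the i.i.d. sequence does not change its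
  law (\<open>PiM_iter\<close>); Fubini then separates the first arrival from the rest.\<close>

lemma nn_integral_Exp_seq_case_nat:
  assumes [measurable]: "f \<in> borel_measurable Seq"
  shows "(\<integral>\<^sup>+w. f w \<partial>Exp_seq l) = (\<integral>\<^sup>+s. \<integral>\<^sup>+w. f (case_nat s w) \<partial>Exp_seq l \<partial>Exp_law l)"
    and "(\<lambda>s. \<integral>\<^sup>+w. f (case_nat s w) \<partial>Exp_seq l) \<in> borel_measurable Ups"
proof -
  interpret Exp: sequence_space "Exp_law l"
    by (rule sequence_space_Exp_law)
  have f [measurable]: "f \<in> borel_measurable (Exp_seq l)"
    using assms by (simp cong: measurable_cong_sets add: measurable_cong_sets[OF sets_Exp_seq])
  have m [measurable]: "(\<lambda>(s, w). case_nat s w) \<in> measurable (Exp_law l \<Otimes>\<^sub>M Exp_seq l) (Exp_seq l)"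
    by measurable
  then have fm: "(\<lambda>x. f (case x of (s, w) \<Rightarrow> case_nat s w)) \<in> borel_measurable (Exp_law l \<Otimes>\<^sub>M Exp_seq l)"
    by (rule measurable_compose) (rule f)
  have "(\<integral>\<^sup>+w. f w \<partial>Exp_seq l) =
      (\<integral>\<^sup>+w. f w \<partial>distr (Exp_law l \<Otimes>\<^sub>M Exp_seq l) (Exp_seq l) (\<lambda>(s, w). case_nat s w))"
    by (simp only: Exp.PiM_iter)
  also have "\<dots> = (\<integral>\<^sup>+x. f (case x of (s, w) \<Rightarrow> case_nat s w) \<partial>(Exp_law l \<Otimes>\<^sub>M Exp_seq l))"
    by (intro nn_integral_distr m) (simp add: f)
  also have "\<dots> = (\<integral>\<^sup>+s. \<integral>\<^sup>+w. f (case_nat s w) \<partial>Exp_seq l \<partial>Exp_law l)"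
    using Exp.P.nn_integral_fst[OF fm] by simp
  finally show "(\<integral>\<^sup>+w. f w \<partial>Exp_seq l) = (\<integral>\<^sup>+s. \<integral>\<^sup>+w. f (case_nat s w) \<partial>Exp_seq l \<partial>Exp_law l)" .
  show "(\<lambda>s. \<integral>\<^sup>+w. f (case_nat s w) \<partial>Exp_seq l) \<in> borel_measurable Ups"
    using Exp.P.borel_measurable_nn_integral_fst[OF fm]
    by (simp add: measurable_cong_sets[OF sets_Exp_law])
qed

text \<open>Memorylessness. For \<open>n = 0\<close> this is a translation of the exponential density, and the
  induction step conditions on the first arrival.\<close>

lemma nn_integral_restart:
  assumes "0 \<le> t" and g: "g \<in> borel_measurable Seq"
  shows "(\<integral>\<^sup>+w. indicator {enat n} (cnt t w) * g (restart n t w) \<partial>Exp_seq l) =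
    ennreal ((l * t) ^ n / fact n * exp (- l * t)) * (\<integral>\<^sup>+w. g w \<partial>Exp_seq l)"
  using \<open>0 \<le> t\<close>
proof (induction n arbitrary: t)
  case 0
  \<comment> \<open>\<open>G s\<close> is the mean of \<open>g\<close> when the first entry is fixed
    to \<open>s\<close>.\<close>
  define G where "G s = (\<integral>\<^sup>+w. g (case_nat s w) \<partial>Exp_seq l)" for s
  have G: "G \<in> borel_measurable Ups"
    unfolding G_def by (rule nn_integral_Exp_seq_case_nat(2)[OF g])
  then have G' [measurable]: "(\<lambda>s. G s * indicator {0<..} s) \<in> borel_measurable borel"
    unfolding Ups_def by (subst (asm) borel_measurable_restrict_space_iff_ennreal) auto
  have "(\<integral>\<^sup>+w. indicator {enat 0} (cnt t w) * g (restart 0 t w) \<partial>Exp_seq l) =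
      (\<integral>\<^sup>+s. \<integral>\<^sup>+w. indicator {enat 0} (cnt t (case_nat s w)) * g (restart 0 t (case_nat s w))
        \<partial>Exp_seq l \<partial>Exp_law l)"
    by (intro nn_integral_Exp_seq_case_nat measurable_restart_on_cnt 0 g)
  also have "\<dots> = (\<integral>\<^sup>+s. G (s - t) * indicator {0<..} (s - t) \<partial>Exp_law l)"
  proof (intro nn_integral_cong)
    fix s assume "s \<in> space (Exp_law l)"
    then have s: "0 < s"
      by (simp add: space_Exp_law)
    have "(\<integral>\<^sup>+w. indicator {enat 0} (cnt t (case_nat s w)) * g (restart 0 t (case_nat s w)) \<partial>Exp_seq l) =
        (\<integral>\<^sup>+w. indicator {0<..} (s - t) * g (case_nat (s - t) w) \<partial>Exp_seq l)"
      using s 0 by (intro nn_integral_cong)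
        (simp add: space_Exp_seq cnt_case_nat_eq_0_iff restart_0_case_nat indicator_def)
    also have "\<dots> = G (s - t) * indicator {0<..} (s - t)"
      unfolding G_def by (auto simp: indicator_def)
    finally show "(\<integral>\<^sup>+w. indicator {enat 0} (cnt t (case_nat s w)) * g (restart 0 t (case_nat s w))
      \<partial>Exp_seq l) = G (s - t) * indicator {0<..} (s - t)" .
  qed
  also have "\<dots> = (\<integral>\<^sup>+s. ennreal (l * exp (- l * s)) * ((G (s - t) * indicator {0<..} (s - t)) *
      indicator {0<..} s) \<partial>lborel)"
    using measurable_compose[OF measurable_Ups_borel, of "\<lambda>s. G (s - t) * indicator {0<..} (s - t)" borel]
    by (intro nn_integral_Exp_law) simp
  \<comment> \<open>Translation by \<open>t\<close>: the residual time \<open>s - t\<close> becomes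
    the variable of integration.\<close>
  also have "\<dots> = (\<integral>\<^sup>+s. ennreal (l * exp (- l * (t + s))) * ((G s * indicator {0<..} s) *
      indicator {0<..} (t + s)) \<partial>lborel)"
    by (subst nn_integral_real_affine[where c = 1 and t = t]) simp_all
  \<comment> \<open>The exponential factorises, and \<open>0 < s\<close> already implies
    \<open>0 < t + s\<close>, so one indicator is enough.\<close>
  also have "\<dots> = (\<integral>\<^sup>+s. ennreal (exp (- l * t)) * (ennreal (l * exp (- l * s)) *
      (G s * indicator {0<..} s)) \<partial>lborel)"
  proof (intro nn_integral_cong)
    fix s
    have "exp (- l * (t + s)) = exp (- l * t) * exp (- l * s)"
      unfolding exp_add[symmetric] by (simp add: algebra_simps)
    then have "ennreal (l * exp (- l * (t + s))) = ennreal (exp (- l * t)) * ennreal (l * exp (- l * s))"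
      using l by (subst ennreal_mult[symmetric]) (simp_all add: mult.left_commute)
    then show "ennreal (l * exp (- l * (t + s))) * ((G s * indicator {0<..} s) * indicator {0<..} (t + s)) =
        ennreal (exp (- l * t)) * (ennreal (l * exp (- l * s)) * (G s * indicator {0<..} s))"
      using \<open>0 \<le> t\<close> by (cases "0 < s") (simp_all add: mult.assoc)
  qed
  also have "\<dots> = ennreal (exp (- l * t)) * (\<integral>\<^sup>+s. G s \<partial>Exp_law l)"
    unfolding nn_integral_Exp_law[OF G] by (intro nn_integral_cmult) simp
  also have "(\<integral>\<^sup>+s. G s \<partial>Exp_law l) = (\<integral>\<^sup>+w. g w \<partial>Exp_seq l)"
    unfolding G_def by (rule nn_integral_Exp_seq_case_nat(1)[OF g, symmetric])
  finally show ?case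
    by simp
next
  case (Suc n)
  define I where "I = (\<integral>\<^sup>+w. g w \<partial>Exp_seq l)"
  let ?p = "\<lambda>s. (l * (t - s)) ^ n / fact n * exp (- l * (t - s))"
  have "(\<integral>\<^sup>+w. indicator {enat (Suc n)} (cnt t w) * g (restart (Suc n) t w) \<partial>Exp_seq l) =
      (\<integral>\<^sup>+s. \<integral>\<^sup>+w. indicator {enat (Suc n)} (cnt t (case_nat s w)) * g (restart (Suc n) t (case_nat s w))
        \<partial>Exp_seq l \<partial>Exp_law l)"
    by (intro nn_integral_Exp_seq_case_nat measurable_restart_on_cnt Suc.prems g)
  also have "\<dots> = (\<integral>\<^sup>+s. ennreal (?p s) * indicator {..t} s * I \<partial>Exp_law l)"
  proof (intro nn_integral_cong)
    fix s assume "s \<in> space (Exp_law l)"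
    then have s: "0 < s"
      by (simp add: space_Exp_law)
    have "(\<integral>\<^sup>+w. indicator {enat (Suc n)} (cnt t (case_nat s w)) * g (restart (Suc n) t (case_nat s w)) \<partial>Exp_seq l) =
        (\<integral>\<^sup>+w. indicator {..t} s * (indicator {enat n} (cnt (t - s) w) * g (restart n (t - s) w)) \<partial>Exp_seq l)"
      using s Suc.prems by (intro nn_integral_cong)
        (simp add: space_Exp_seq cnt_case_nat_eq_Suc_iff restart_Suc_case_nat indicator_def)
    \<comment> \<open>The induction hypothesis applies at time \<open>t - s\<close> when
      \<open>s \<le> t\<close>; otherwise the indicator makes both sides 0.\<close>
    also have "\<dots> = ennreal (?p s) * indicator {..t} s * I"
      using Suc.IH[of "t - s"] unfolding I_def by (simp add: indicator_def)
    finally show "(\<integral>\<^sup>+w. indicator {enat (Suc n)} (cnt t (case_nat s w)) *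
      g (restart (Suc n) t (case_nat s w)) \<partial>Exp_seq l) = ennreal (?p s) * indicator {..t} s * I" .
  qed
  also have "\<dots> = (\<integral>\<^sup>+s. ennreal (l * exp (- l * s)) * ((ennreal (?p s) * indicator {..t} s * I) *
      indicator {0<..} s) \<partial>lborel)"
    using measurable_compose[OF measurable_Ups_borel, of "\<lambda>s. ennreal (?p s) * indicator {..t} s * I" borel]
    by (intro nn_integral_Exp_law) simp
  also have "\<dots> = (\<integral>\<^sup>+s. I * (ennreal (l * exp (- l * s) * ?p s) * indicator {0<..t} s) \<partial>lborel)"
  proof (intro nn_integral_cong)
    fix s
    show "ennreal (l * exp (- l * s)) * ((ennreal (?p s) * indicator {..t} s * I) * indicator {0<..} s) =
        I * (ennreal (l * exp (- l * s) * ?p s) * indicator {0<..t} s)"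
    proof (cases "0 < s \<and> s \<le> t")
      case True
      then have *: "ennreal (l * exp (- l * s) * ?p s) = ennreal (l * exp (- l * s)) * ennreal (?p s)"
        using l by (intro ennreal_mult) simp_all
      from True show ?thesis
        unfolding * by (simp add: ac_simps)
    qed (auto simp: indicator_def)
  qed
  also have "\<dots> = I * (\<integral>\<^sup>+s. ennreal (l * exp (- l * s) * ?p s) * indicator {0<..t} s \<partial>lborel)"
    by (intro nn_integral_cmult) simp
  also have "(\<integral>\<^sup>+s. ennreal (l * exp (- l * s) * ?p s) * indicator {0<..t} s \<partial>lborel) =
      ennreal ((l * t) ^ Suc n / fact (Suc n) * exp (- l * t))"
    by (rule nn_integral_Erlang[OF l Suc.prems])
  finally show ?case
    unfolding I_def by (simp only: mult.commute)
qed

lemma prob_space_Exp_seq: "prob_space (Exp_seq l)"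
  by (intro prob_space_PiM prob_space_Exp_law l)

lemma emeasure_space_Exp_seq: "emeasure (Exp_seq l) (space (Exp_seq l)) = 1"
  by (rule prob_space.emeasure_space_1[OF prob_space_Exp_seq])

section \<open>The Poisson law of the number of arrivals\<close>

lemma emeasure_cnt_eq:
  assumes "0 \<le> t"
  shows "emeasure (Exp_seq l) {w \<in> space (Exp_seq l). cnt t w = enat n} =
    ennreal ((l * t) ^ n / fact n * exp (- l * t))"
proof -
  have "emeasure (Exp_seq l) {w \<in> space (Exp_seq l). cnt t w = enat n} =
      (\<integral>\<^sup>+w. indicator {w \<in> space (Exp_seq l). cnt t w \<in> {enat n}} w \<partial>Exp_seq l)"
    using sets_cnt_Exp_seq[OF assms, of l "{enat n}"] by (subst nn_integral_indicator) simp_all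
  also have "\<dots> = (\<integral>\<^sup>+w. indicator {enat n} (cnt t w) * 1 \<partial>Exp_seq l)"
    by (intro nn_integral_cong) (simp add: indicator_def)
  \<comment> \<open>Memorylessness with the constant function 1 in place of
    \<open>g\<close>.\<close>
  also have "\<dots> = ennreal ((l * t) ^ n / fact n * exp (- l * t))"
    using nn_integral_restart[OF assms, of "\<lambda>_. 1" n] by (simp add: emeasure_space_Exp_seq)
  finally show ?thesis .
qed

text \<open>By the exponential series the probabilities of the disjoint finite levels add up to 1,
  so no mass is left for \<open>\<infinity>\<close>.\<close>

lemma AE_cnt_finite:
  assumes "0 \<le> t"
  shows "AE w in Exp_seq l. cnt t w \<noteq> \<infinity>"
proof -
  let ?p = "\<lambda>n. (l * t) ^ n / fact n * exp (- l * t)"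
  let ?B = "\<lambda>n. {w \<in> space (Exp_seq l). cnt t w = enat n}"
  have "(\<lambda>n. (l * t) ^ n / fact n) sums exp (l * t)"
    using exp_converges[of "l * t"] by (simp add: divide_inverse mult.commute)
  then have "?p sums (exp (l * t) * exp (- l * t))"
    by (rule sums_mult2)
  then have p: "?p sums 1"
    by (simp add: exp_add[symmetric])
  have B: "?B n \<in> sets (Exp_seq l)" for n
    using sets_cnt_Exp_seq[OF assms, of l "{enat n}"] by simp
  have "emeasure (Exp_seq l) (\<Union>n. ?B n) = (\<Sum>n. emeasure (Exp_seq l) (?B n))"
    using B by (intro suminf_emeasure[symmetric]) (auto simp: disjoint_family_on_def)
  also have "\<dots> = (\<Sum>n. ennreal (?p n))"
    by (simp only: emeasure_cnt_eq[OF assms])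
  also have "\<dots> = 1"
    using p l assms by (subst suminf_ennreal2) (auto simp: sums_iff)
  finally have "AE w in Exp_seq l. w \<in> (\<Union>n. ?B n)"
    using prob_space.AE_prob_1[OF prob_space_Exp_seq, of "\<Union>n. ?B n"] by (simp add: measure_def)
  then show ?thesis
    by (rule eventually_mono) auto
qed

text \<open>Memorylessness summed over the values of the count: outside the null set of infinite
  counts exactly one level indicator is nonzero.\<close>

lemma nn_integral_restart_suminf:
  assumes t: "0 \<le> t" and g: "g \<in> borel_measurable Seq"
  shows "(\<integral>\<^sup>+w. indicator A (cnt t w) * g (restart (the_enat (cnt t w)) t w) \<partial>Exp_seq l) =
    (\<Sum>n. indicator A (enat n) * ennreal ((l * t) ^ n / fact n * exp (- l * t))) * (\<integral>\<^sup>+w. g w \<partial>Exp_seq l)"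
proof -
  have "AE w in Exp_seq l. indicator A (cnt t w) * g (restart (the_enat (cnt t w)) t w) =
      (\<Sum>n. indicator A (enat n) * (indicator {enat n} (cnt t w) * g (restart n t w)))"
    using AE_cnt_finite[OF t]
  proof (rule eventually_mono)
    fix w assume "cnt t w \<noteq> \<infinity>"
    then obtain m where m: "cnt t w = enat m"
      by auto
    have "sum f {m} = f m" for f :: "nat \<Rightarrow> ennreal"
      by simp
    moreover have "(\<Sum>n. indicator A (enat n) * (indicator {enat n} (cnt t w) * g (restart n t w))) =
        (\<Sum>n\<in>{m}. indicator A (enat n) * (indicator {enat n} (cnt t w) * g (restart n t w)))"
      using m by (intro suminf_finite) auto
    ultimately have "(\<Sum>n. indicator A (enat n) * (indicator {enat n} (cnt t w) * g (restart n t w))) =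
        indicator A (enat m) * (indicator {enat m} (cnt t w) * g (restart m t w))"
      by (simp only:)
    with m show "indicator A (cnt t w) * g (restart (the_enat (cnt t w)) t w) =
        (\<Sum>n. indicator A (enat n) * (indicator {enat n} (cnt t w) * g (restart n t w)))"
      by simp
  qed
  then have "(\<integral>\<^sup>+w. indicator A (cnt t w) * g (restart (the_enat (cnt t w)) t w) \<partial>Exp_seq l) =
      (\<integral>\<^sup>+w. (\<Sum>n. indicator A (enat n) * (indicator {enat n} (cnt t w) * g (restart n t w))) \<partial>Exp_seq l)"
    by (rule nn_integral_cong_AE)
  also have "\<dots> = (\<Sum>n. \<integral>\<^sup>+w. indicator A (enat n) * (indicator {enat n} (cnt t w) * g (restart n t w)) \<partial>Exp_seq l)"
    using measurable_restart_on_cnt[OF t g]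
    by (intro nn_integral_suminf borel_measurable_times_ennreal[OF borel_measurable_const])
      (simp add: measurable_cong_sets[OF sets_Exp_seq])
  also have "\<dots> = (\<Sum>n. (indicator A (enat n) * ennreal ((l * t) ^ n / fact n * exp (- l * t))) * (\<integral>\<^sup>+w. g w \<partial>Exp_seq l))"
  proof (intro suminf_cong)
    fix n
    show "(\<integral>\<^sup>+w. indicator A (enat n) * (indicator {enat n} (cnt t w) * g (restart n t w)) \<partial>Exp_seq l) =
        (indicator A (enat n) * ennreal ((l * t) ^ n / fact n * exp (- l * t))) * (\<integral>\<^sup>+w. g w \<partial>Exp_seq l)"
      using nn_integral_restart[OF t g, of n] by (cases "enat n \<in> A") simp_all
  qed
  also have "\<dots> = (\<Sum>n. indicator A (enat n) * ennreal ((l * t) ^ n / fact n * exp (- l * t))) * (\<integral>\<^sup>+w. g w \<partial>Exp_seq l)"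
    by simp
  finally show ?thesis .
qed

lemma emeasure_cnt_suminf:
  assumes t: "0 \<le> t"
  shows "emeasure (Exp_seq l) {w \<in> space (Exp_seq l). cnt t w \<in> A} =
    (\<Sum>n. indicator A (enat n) * ennreal ((l * t) ^ n / fact n * exp (- l * t)))"
proof -
  have "emeasure (Exp_seq l) {w \<in> space (Exp_seq l). cnt t w \<in> A} =
      (\<integral>\<^sup>+w. indicator {w \<in> space (Exp_seq l). cnt t w \<in> A} w \<partial>Exp_seq l)"
    using sets_cnt_Exp_seq[OF assms] by (subst nn_integral_indicator) simp_all
  also have "\<dots> = (\<integral>\<^sup>+w. indicator A (cnt t w) * 1 \<partial>Exp_seq l)"
    by (intro nn_integral_cong) (simp add: indicator_def)
  finally show ?thesis
    using nn_integral_restart_suminf[OF t, of "\<lambda>_. 1" A] by (simp add: emeasure_space_Exp_seq)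
qed

text \<open>For indicators \<open>g\<close> this says that the sequence seen from \<open>t\<close>
  on is independent of the count at \<open>t\<close> and has again the law
  \<open>Exp_seq l\<close>.\<close>

lemma nn_integral_restart_cnt:
  assumes t: "0 \<le> t" and g: "g \<in> borel_measurable Seq"
  shows "(\<integral>\<^sup>+w. indicator A (cnt t w) * g (restart (the_enat (cnt t w)) t w) \<partial>Exp_seq l) =
    emeasure (Exp_seq l) {w \<in> space (Exp_seq l). cnt t w \<in> A} * (\<integral>\<^sup>+w. g w \<partial>Exp_seq l)"
  unfolding nn_integral_restart_suminf[OF assms] emeasure_cnt_suminf[OF t] ..

text \<open>Both sides are the same series over the finite elements of \<open>A\<close>: the Poisson
  law lives on \<open>nat\<close>, and the count is almost surely finite.\<close>

lemma emeasure_cnt_poisson: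
  assumes "0 < t"
  shows "emeasure (Exp_seq l) {w \<in> space (Exp_seq l). cnt t w \<in> A} =
    emeasure (measure_pmf (poisson_pmf (t * l))) (enat -` A)"
proof -
  have "emeasure (measure_pmf (poisson_pmf (t * l))) (enat -` A) =
      (\<integral>\<^sup>+n. indicator (enat -` A) n \<partial>measure_pmf (poisson_pmf (t * l)))"
    by simp
  also have "\<dots> = (\<Sum>n. ennreal (pmf (poisson_pmf (t * l)) n) * indicator (enat -` A) n)"
    by (simp only: nn_integral_measure_pmf nn_integral_count_space_nat)
  also have "\<dots> = (\<Sum>n. indicator A (enat n) * ennreal ((l * t) ^ n / fact n * exp (- l * t)))"
    using assms l by (intro suminf_cong) (simp add: indicator_def mult.commute)
  finally show ?thesis
    using assms by (simp add: emeasure_cnt_suminf)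
qed

section \<open>Stationary independent increments\<close>

lemma emeasure_incr_event_restart:
  assumes "0 \<le> u" "\<And>j. j \<le> m \<Longrightarrow> u \<le> t j"
  shows "emeasure (Exp_seq l) {w \<in> space (Exp_seq l). cnt u w \<in> B \<and> w \<in> incr_event m t A} =
    emeasure (Exp_seq l) {w \<in> space (Exp_seq l). cnt u w \<in> B} *
    emeasure (Exp_seq l) (incr_event m (\<lambda>j. t j - u) A)"
proof -
  \<comment> \<open>\<open>the_enat\<close> is meaningful only where the count is finite, that is
    almost everywhere.\<close>
  let ?r = "\<lambda>w. restart (the_enat (cnt u w)) u w"
  have D: "incr_event m t A \<in> sets (Exp_seq l)" "incr_event m (\<lambda>j. t j - u) A \<in> sets (Exp_seq l)"
    unfolding sets_Exp_seq using assms by (auto intro!: sets_incr_event intro: order_trans)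
  have "{w \<in> space (Exp_seq l). cnt u w \<in> B \<and> w \<in> incr_event m t A} \<in> sets (Exp_seq l)"
    using sets.Int[OF sets_cnt_Exp_seq[OF assms(1), of l B] D(1)] by (simp add: Int_def conj_assoc)
  then have "emeasure (Exp_seq l) {w \<in> space (Exp_seq l). cnt u w \<in> B \<and> w \<in> incr_event m t A} =
      (\<integral>\<^sup>+w. indicator {w \<in> space (Exp_seq l). cnt u w \<in> B \<and> w \<in> incr_event m t A} w \<partial>Exp_seq l)"
    by simp
  also have "\<dots> = (\<integral>\<^sup>+w. indicator B (cnt u w) * indicator (incr_event m (\<lambda>j. t j - u) A) (?r w) \<partial>Exp_seq l)"
    using AE_cnt_finite[OF assms(1)] AE_space
  proof (intro nn_integral_cong_AE, eventually_elim)
    fix w assume w: "w \<in> space (Exp_seq l)" and "cnt u w \<noteq> \<infinity>"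
    \<comment> \<open>All time points lie after \<open>u\<close>, so the increments are those of the
      restarted sequence with times moved back by \<open>u\<close>.\<close>
    then have "w \<in> incr_event m t A \<longleftrightarrow> ?r w \<in> incr_event m (\<lambda>j. t j - u) A"
      using cnt_diff_restart[of w u] assms restart_pos[of w]
      by (simp add: incr_event_def space_Exp_seq)
    with w show "indicator {w \<in> space (Exp_seq l). cnt u w \<in> B \<and> w \<in> incr_event m t A} w =
      indicator B (cnt u w) * (indicator (incr_event m (\<lambda>j. t j - u) A) (?r w) :: ennreal)"
      by (simp add: indicator_def)
  qed
  also have "\<dots> = emeasure (Exp_seq l) {w \<in> space (Exp_seq l). cnt u w \<in> B} *
      (\<integral>\<^sup>+w. indicator (incr_event m (\<lambda>j. t j - u) A) w \<partial>Exp_seq l)"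
    using D(2) by (intro nn_integral_restart_cnt assms(1)) (simp add: sets_Exp_seq)
  also have "(\<integral>\<^sup>+w. indicator (incr_event m (\<lambda>j. t j - u) A) w \<partial>Exp_seq l) =
      emeasure (Exp_seq l) (incr_event m (\<lambda>j. t j - u) A)"
    using D(2) by simp
  finally show ?thesis .
qed

text \<open>Induction on the number of increments. Restarting at \<open>t 0\<close> moves the first
  time point to 0; restarting again at the second one separates the first increment from the
  others.\<close>

lemma emeasure_incr_event:
  assumes "0 \<le> t 0" "\<And>j. j < m \<Longrightarrow> t j \<le> t (Suc j)"
  shows "emeasure (Exp_seq l) (incr_event m t A) =
    (\<Prod>j<m. emeasure (Exp_seq l) {w \<in> space (Exp_seq l). cnt (t (Suc j) - t j) w \<in> A j})"
  using assms
proof (induction m arbitrary: t A)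
  case 0
  then show ?case
    using emeasure_space_Exp_seq by (simp add: incr_event_def space_Exp_seq)
next
  case (Suc m)
  let ?s = "\<lambda>j. t j - t 0"
  have mono: "t i \<le> t j" if "i \<le> j" "j \<le> Suc m" for i j
    using that Suc.prems(2) by (induction rule: dec_induct) (auto intro: order_trans)
  \<comment> \<open>The vacuous condition \<open>UNIV\<close> on the count at \<open>t 0\<close>
    gives the event the shape to which restarting applies.\<close>
  have "emeasure (Exp_seq l) (incr_event (Suc m) t A) =
      emeasure (Exp_seq l) {w \<in> space (Exp_seq l). cnt (t 0) w \<in> UNIV \<and> w \<in> incr_event (Suc m) t A}"
    by (intro arg_cong[where f = "emeasure _"]) (auto simp: incr_event_def space_Exp_seq)
  also have "\<dots> = emeasure (Exp_seq l) (incr_event (Suc m) ?s A)"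
    using mono Suc.prems(1) emeasure_space_Exp_seq by (subst emeasure_incr_event_restart) auto
  \<comment> \<open>As the count at time 0 is 0, the first increment is simply the count at
    \<open>?s 1\<close>.\<close>
  also have "\<dots> = emeasure (Exp_seq l) {w \<in> space (Exp_seq l). cnt (?s 1) w \<in> A 0 \<and>
      w \<in> incr_event m (\<lambda>j. ?s (Suc j)) (\<lambda>j. A (Suc j))}"
    by (intro arg_cong[where f = "emeasure _"])
      (auto simp: incr_event_def space_Exp_seq All_less_Suc2 cnt_0)
  also have "\<dots> = emeasure (Exp_seq l) {w \<in> space (Exp_seq l). cnt (?s 1) w \<in> A 0} *
      emeasure (Exp_seq l) (incr_event m (\<lambda>j. ?s (Suc j) - ?s 1) (\<lambda>j. A (Suc j)))"
    using mono by (intro emeasure_incr_event_restart) auto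
  also have "emeasure (Exp_seq l) (incr_event m (\<lambda>j. ?s (Suc j) - ?s 1) (\<lambda>j. A (Suc j))) =
      (\<Prod>j<m. emeasure (Exp_seq l) {w \<in> space (Exp_seq l). cnt (t (Suc (Suc j)) - t (Suc j)) w \<in> A (Suc j)})"
    using Suc.prems by (subst Suc.IH) simp_all
  finally show ?case
    by (simp only: prod.lessThan_Suc_shift One_nat_def)
qed


text \<open>Stationarity is the product formula for a single increment, with time points
  \<open>s\<close> and \<open>t\<close>.\<close>

lemma emeasure_cnt_diff:
  assumes "0 \<le> s" "s \<le> t"
  shows "emeasure (Exp_seq l) {w \<in> space (Exp_seq l). cnt t w - cnt s w \<in> B} =
    emeasure (Exp_seq l) {w \<in> space (Exp_seq l). cnt (t - s) w \<in> B}"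
proof -
  let ?t = "case_nat s (\<lambda>_. t)"
  have "{w \<in> space (Exp_seq l). cnt t w - cnt s w \<in> B} = incr_event 1 ?t (\<lambda>_. B)"
    by (auto simp: incr_event_def space_Exp_seq)
  then show ?thesis
    using assms emeasure_incr_event[of ?t 1 "\<lambda>_. B"] by simp
qed

lemma indep_sets_cnt_diff:
  assumes "0 \<le> t 0" "\<And>j. j < m \<Longrightarrow> t j \<le> t (Suc j)"
  shows "prob_space.indep_sets (Exp_seq l)
    (\<lambda>j. {{w \<in> space (Exp_seq l). cnt (t (Suc j)) w - cnt (t j) w \<in> B} |B. True}) {..<m}"
proof -
  interpret prob_space "Exp_seq l"
    by (rule prob_space_Exp_seq)
  have nonneg: "0 \<le> t j" if "j \<le> m" for j
    using that by (induction j) (use assms in \<open>auto intro: order_trans\<close>)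
  show ?thesis
  proof (rule indep_setsI)
    fix j assume "j \<in> {..<m}"
    then show "{{w \<in> space (Exp_seq l). cnt (t (Suc j)) w - cnt (t j) w \<in> B} |B. True} \<subseteq> events"
      using measurable_sets[OF measurable_cnt_diff, of "t (Suc j)" "t j"] nonneg
      by (auto simp: sets_Exp_seq vimage_def Int_def space_Exp_seq space_Seq conj_commute)
  next
    fix A J
    assume J: "J \<noteq> {}" "J \<subseteq> {..<m}" "finite J"
      and "\<forall>j\<in>J. A j \<in> {{w \<in> space (Exp_seq l). cnt (t (Suc j)) w - cnt (t j) w \<in> B} |B. True}"
    then obtain B where B: "\<And>j. j \<in> J \<Longrightarrow> A j = {w \<in> space (Exp_seq l). cnt (t (Suc j)) w - cnt (t j) w \<in> B j}"
      by (auto dest!: bchoice)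
    \<comment> \<open>Indices outside \<open>J\<close> get the vacuous condition
      \<open>UNIV\<close>, whose factor is 1; thus the formula for all \<open>m\<close> increments
      covers every subfamily.\<close>
    let ?B = "\<lambda>j. if j \<in> J then B j else UNIV"
    let ?p = "\<lambda>j C. emeasure (Exp_seq l) {w \<in> space (Exp_seq l). cnt (t (Suc j) - t j) w \<in> C}"
    have "(\<Inter>j\<in>J. A j) = incr_event m t ?B"
      using J B by (auto simp: incr_event_def space_Exp_seq)
    then have "emeasure (Exp_seq l) (\<Inter>j\<in>J. A j) = (\<Prod>j<m. ?p j (?B j))"
      using emeasure_incr_event[OF assms] by simp
    also have "\<dots> = (\<Prod>j\<in>J. ?p j (?B j))"
      using J emeasure_space_Exp_seq by (intro prod.mono_neutral_right) auto
    also have "\<dots> = (\<Prod>j\<in>J. emeasure (Exp_seq l) (A j))"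
      using J assms B nonneg by (intro prod.cong) (auto simp: emeasure_cnt_diff)
    finally show "prob (\<Inter>j\<in>J. A j) = (\<Prod>j\<in>J. prob (A j))"
      by (simp add: emeasure_eq_measure prod_ennreal prod_nonneg)
  qed
qed

end

section \<open>Risk processes on the canonical space\<close>

text \<open>Allows two sigma-algebras to be compared by checking measurability of the identity,
  which can be done one coordinate at a time.\<close>

lemma sets_eqI_measurable_id:
  assumes MN: "(\<lambda>x. x) \<in> measurable M N" and NM: "(\<lambda>x. x) \<in> measurable N M"
  shows "sets M = sets N"
proof -
  have "A \<in> sets N" if NM: "(\<lambda>x. x) \<in> measurable N M" and MN: "(\<lambda>x. x) \<in> measurable M N"
    and A: "A \<in> sets M" for A and M N :: "'a measure"
  proof -
    have "(\<lambda>x. x) -` A \<inter> space N = A"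
      using sets.sets_into_space[OF A] measurable_space[OF MN] by auto
    with measurable_sets[OF NM A] show ?thesis
      by simp
  qed
  from this[OF NM MN] this[OF MN NM] show ?thesis
    by blast
qed

text \<open>Coordinate projections are continuous, hence Borel, which gives one direction.
  Conversely, Borel measurability into a countable product of real lines may be checked on
  coordinates.\<close>

lemma sets_Sig: "sets Sig = sets (Seq \<Otimes>\<^sub>M (Seq \<Otimes>\<^sub>M Ups))"
proof (rule sets_eqI_measurable_id)
  have "(\<lambda>x. (fst x, fst (snd x), snd (snd x))) \<in> measurable Sig (Seq \<Otimes>\<^sub>M (Seq \<Otimes>\<^sub>M Ups))"
  proof (intro measurable_Pair measurable_PiM_single' measurable_UpsI)
    show "(\<lambda>x. fst x k) \<in> borel_measurable Sig" "(\<lambda>x. fst (snd x) k) \<in> borel_measurable Sig" for k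
      unfolding Sig_def
      by (rule measurable_restrict_space1, rule measurable_compose[OF _ measurable_product_coordinates],
          intro borel_measurable_continuous_onI continuous_intros)+
    show "(\<lambda>x. snd (snd x)) \<in> borel_measurable Sig"
      unfolding Sig_def
      by (intro measurable_restrict_space1 borel_measurable_continuous_onI continuous_intros)
  qed (auto simp: Sig_def Omega_def space_restrict_space space_Ups)
  then show "(\<lambda>x. x) \<in> measurable Sig (Seq \<Otimes>\<^sub>M (Seq \<Otimes>\<^sub>M Ups))"
    by simp
  have "(\<lambda>x. (fst x, fst (snd x), snd (snd x))) \<in>
      borel_measurable (Seq \<Otimes>\<^sub>M (Seq \<Otimes>\<^sub>M Ups))"
    unfolding borel_prod[symmetric]
    by (intro measurable_Pair measurable_coordinatewise_then_product
        measurable_compose[OF measurable_fst measurable_Seq_component]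
        measurable_compose[OF measurable_snd measurable_compose[OF measurable_fst measurable_Seq_component]]
        measurable_compose[OF measurable_snd measurable_compose[OF measurable_snd measurable_Ups_borel]])
  then show "(\<lambda>x. x) \<in> measurable (Seq \<Otimes>\<^sub>M (Seq \<Otimes>\<^sub>M Ups)) Sig"
    unfolding Sig_def
    by (intro measurable_restrict_space2)
      (auto simp: Omega_def space_pair_measure space_Seq space_Ups)
qed

lemma space_Sig: "space Sig = Omega"
  by (simp add: Sig_def space_restrict_space)

lemma Omega_eq: "Omega = space Seq \<times> space Seq \<times> space Ups"
  by (auto simp: Omega_def space_Seq space_Ups)

lemma measurable_fst_Sig [measurable]: "fst \<in> measurable Sig Seq"
  by (simp add: measurable_cong_sets[OF sets_Sig refl])

lemma measurable_fst_snd_Sig: "(\<lambda>x. fst (snd x)) \<in> measurable Sig Seq"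
  by (simp add: measurable_cong_sets[OF sets_Sig refl])

lemma proj_Theta_eq: "proj_Theta = (\<lambda>x. snd (snd x))"
  by (auto simp: proj_Theta_def)

lemma measurable_proj_Theta: "proj_Theta \<in> measurable Sig Ups"
  unfolding proj_Theta_eq by (simp add: measurable_cong_sets[OF sets_Sig refl])

text \<open>Each \<open>Z i\<close> factors through \<open>f\<close>, and the preimages under
  \<open>f\<close> already form a sigma-algebra. This reduces events of a whole process to events of
  one coordinate of the canonical space.\<close>

lemma process_events_subset:
  assumes f: "f \<in> measurable M L'"
    and z: "\<And>i. i \<in> I \<Longrightarrow> z i \<in> measurable L' L"
    and Z: "\<And>i x. i \<in> I \<Longrightarrow> x \<in> space M \<Longrightarrow> Z i x = z i (f x)"
  shows "process_events M I L Z \<subseteq> {f -` A \<inter> space M |A. A \<in> sets L'}"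
proof -
  have "sets (vimage_algebra (space M) f L') = {f -` A \<inter> space M |A. A \<in> sets L'}"
    using measurable_space[OF f] by (intro sets_vimage_algebra2) auto
  moreover have "sigma_sets (space (vimage_algebra (space M) f L'))
      (\<Union>i\<in>I. {Z i -` A \<inter> space M |A. A \<in> sets L}) \<subseteq> sets (vimage_algebra (space M) f L')"
  proof (rule sets.sigma_sets_subset, safe)
    fix i A assume i: "i \<in> I" and A: "A \<in> sets L"
    have "Z i -` A \<inter> space M = f -` (z i -` A \<inter> space L') \<inter> space M"
      using Z[OF i] measurable_space[OF f] by auto
    also have "\<dots> \<in> sets (vimage_algebra (space M) f L')"
      by (intro in_vimage_algebra measurable_sets[OF z[OF i] A])
    finally show "Z i -` A \<inter> space M \<in> sets (vimage_algebra (space M) f L')" .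
  qed
  ultimately show ?thesis
    by (simp add: process_events_def)
qed

text \<open>An event of the first coordinate and one of the second meet in a rectangle, so
  independence is the product rule for rectangles.\<close>

lemma indep_set_product_rectangles:
  assumes "prob_space R" and R: "sets R = sets Sig"
    and rect: "\<And>A B. A \<in> sets Seq \<Longrightarrow> B \<in> sets Seq \<Longrightarrow>
      emeasure R (A \<times> B \<times> space Ups) = emeasure R (A \<times> space Seq \<times> space Ups) * emeasure R (space Seq \<times> B \<times> space Ups)"
    and E: "E \<subseteq> {fst -` A \<inter> space R |A. A \<in> sets Seq}"
    and F: "F \<subseteq> {(\<lambda>x. fst (snd x)) -` A \<inter> space R |A. A \<in> sets Seq}"
  shows "prob_space.indep_set R E F"
proof -
  interpret prob_space R by fact
  have spR: "space R = Omega"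
    using sets_eq_imp_space_eq[OF R] space_Sig by simp
  show ?thesis
  proof (rule indep_setI)
    show "E \<subseteq> events" "F \<subseteq> events"
      using E F measurable_sets[OF measurable_fst_Sig] measurable_sets[OF measurable_fst_snd_Sig]
      by (auto simp: R spR space_Sig)
    fix a b assume "a \<in> E" "b \<in> F"
    obtain A B where AB: "A \<in> sets Seq" "B \<in> sets Seq" and
      "a = fst -` A \<inter> space R" "b = (\<lambda>x. fst (snd x)) -` B \<inter> space R"
      using subsetD[OF E \<open>a \<in> E\<close>] subsetD[OF F \<open>b \<in> F\<close>] by auto
    then have "a \<inter> b = A \<times> B \<times> space Ups" "a = A \<times> space Seq \<times> space Ups" "b = space Seq \<times> B \<times> space Ups"
      using AB[THEN sets.sets_into_space] unfolding spR Omega_eq by auto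
    then show "prob (a \<inter> b) = prob a * prob b"
      using rect[OF AB] by (simp add: measure_def enn2real_mult)
  qed
qed

section \<open>The canonical counting and size processes\<close>

definition N_path :: "real \<Rightarrow> path \<Rightarrow> enat" where
  "N_path t x = cnt t (fst x)"

text \<open>Interarrival times are read off from entry 0 on, claim sizes from entry 1 on: entry 0 of the
  second coordinate is never used.\<close>

definition X_path :: "nat \<Rightarrow> path \<Rightarrow> real" where
  "X_path n x = fst (snd x) n"

text \<open>Arrival times are partial sums by \<open>Inf_cnt_eq\<close>. The difference, which for
  \<open>n \<ge> 1\<close> is entry \<open>n - 1\<close>, is left unevaluated, since only its
  measurability in the first coordinate is wanted.\<close>

lemma interarrival_N_path:
  assumes "x \<in> Omega"
  shows "interarrival N_path n x = ereal (sum (fst x) {..<n}) - ereal (sum (fst x) {..<n - 1})"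
proof -
  have "\<forall>k. 0 < fst x k"
    using assms by (auto simp: Omega_def)
  from Inf_cnt_eq[OF this] have "arrival N_path m x = ereal (sum (fst x) {..<m})" for m
    by (simp add: arrival_def N_path_def)
  then show ?thesis
    by (simp add: interarrival_def)
qed

lemma process_events_N_path:
  assumes "sets R = sets Sig"
  shows "process_events R {0..} (count_space UNIV) N_path \<subseteq> {fst -` A \<inter> space R |A. A \<in> sets Seq}"
  by (rule process_events_subset[where z = cnt])
    (auto simp: N_path_def measurable_cnt measurable_cong_sets[OF assms refl] measurable_fst_Sig)

lemma process_events_interarrival_N_path:
  assumes "sets R = sets Sig"
  shows "process_events R {1..} borel (interarrival N_path) \<subseteq> {fst -` A \<inter> space R |A. A \<in> sets Seq}"
proof (rule process_events_subset[where z = "\<lambda>n w. ereal (sum w {..<n}) - ereal (sum w {..<n - 1})"])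
  show "(\<lambda>w. ereal (sum w {..<n}) - ereal (sum w {..<n - 1})) \<in> borel_measurable Seq" for n
    by measurable
qed (use sets_eq_imp_space_eq[OF assms] in
  \<open>auto simp: interarrival_N_path space_Sig measurable_cong_sets[OF assms refl] measurable_fst_Sig\<close>)

lemma process_events_X_path:
  assumes "sets R = sets Sig"
  shows "process_events R {1..} Ups X_path \<subseteq> {(\<lambda>x. fst (snd x)) -` A \<inter> space R |A. A \<in> sets Seq}"
  by (rule process_events_subset[where z = "\<lambda>n w. w n"])
    (auto simp: X_path_def measurable_cong_sets[OF assms refl] measurable_fst_snd_Sig)

lemma measurable_N_path: "0 \<le> t \<Longrightarrow> N_path t \<in> measurable Sig (count_space UNIV)"
  unfolding N_path_def by (rule measurable_compose[OF measurable_fst_Sig measurable_cnt])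

text \<open>Finiteness is assumed separately at each natural time; countably many null sets can be
  united into one, outside which the path properties of \<open>cnt\<close> apply.\<close>

lemma counting_process_N_path:
  assumes R: "sets R = sets Sig" and fin: "\<And>n::nat. AE x in R. cnt (real n) (fst x) \<noteq> \<infinity>"
  shows "counting_process R N_path"
  unfolding counting_process_def
proof (intro conjI allI impI)
  show "N_path t \<in> measurable R (count_space UNIV)" if "0 \<le> t" for t
    using measurable_N_path[OF that] by (simp add: measurable_cong_sets[OF R refl])
  have "AE x in R. \<forall>n::nat. cnt (real n) (fst x) \<noteq> \<infinity>"
    using fin by (simp add: AE_all_countable)
  then show "AE x in R. N_path 0 x = 0 \<and>
        (\<forall>s t. 0 \<le> s \<longrightarrow> s \<le> t \<longrightarrow> N_path s x \<le> N_path t x) \<and>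
        (\<forall>t\<ge>0. ((\<lambda>s. N_path s x) \<longlongrightarrow> N_path t x) (at_right t)) \<and>
        (\<forall>t>0. (SUP s\<in>{0..<t}. N_path s x) \<le> N_path t x \<and> N_path t x \<le> (SUP s\<in>{0..<t}. N_path s x) + 1) \<and>
        (SUP t\<in>{0..}. N_path t x) = \<infinity>"
    using AE_space
  proof eventually_elim
    fix x assume "x \<in> space R" and fin: "\<forall>n::nat. cnt (real n) (fst x) \<noteq> \<infinity>"
    then have w: "\<forall>k. 0 < fst x k"
      using sets_eq_imp_space_eq[OF R] by (auto simp: space_Sig Omega_def)
    \<comment> \<open>Every time lies below a natural number, and counts are monotone.\<close>
    have fin: "cnt t (fst x) \<noteq> \<infinity>" for t
      using fin cnt_mono[OF real_nat_ceiling_ge[of t], of "fst x"] by (metis enat_ord_simps(5))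
    show "N_path 0 x = 0 \<and>
        (\<forall>s t. 0 \<le> s \<longrightarrow> s \<le> t \<longrightarrow> N_path s x \<le> N_path t x) \<and>
        (\<forall>t\<ge>0. ((\<lambda>s. N_path s x) \<longlongrightarrow> N_path t x) (at_right t)) \<and>
        (\<forall>t>0. (SUP s\<in>{0..<t}. N_path s x) \<le> N_path t x \<and> N_path t x \<le> (SUP s\<in>{0..<t}. N_path s x) + 1) \<and>
        (SUP t\<in>{0..}. N_path t x) = \<infinity>"
      unfolding N_path_def
      using cnt_0[OF w] cnt_mono tendsto_cnt_at_right[OF w _ fin] cnt_le_SUP_plus_1[OF w _ fin] SUP_cnt[OF w]
      by (auto intro!: SUP_least cnt_mono)
  qed
qed

lemma process_events_cong_space: "space M = space M' \<Longrightarrow> process_events M = process_events M'"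
  by (simp add: process_events_def fun_eq_iff)

text \<open>Stated for a general \<open>R\<close> to serve both the kernel and the mixture. By
  \<open>rect\<close> the second coordinate is an i.i.d. sequence with law \<open>\<mu>\<close>,
  independent of the first coordinate, which determines \<open>N_path\<close>.\<close>

lemma risk_process_path:
  assumes "prob_space R" and R: "sets R = sets Sig"
    and "prob_space \<mu>" and \<mu>: "sets \<mu> = sets Ups"
    and fin: "\<And>n::nat. AE x in R. cnt (real n) (fst x) \<noteq> \<infinity>"
    and rect: "\<And>A B. A \<in> sets Seq \<Longrightarrow> B \<in> sets Seq \<Longrightarrow>
      emeasure R (A \<times> B \<times> space Ups) =
      emeasure R (A \<times> space Seq \<times> space Ups) * emeasure (\<Pi>\<^sub>M n\<in>UNIV. \<mu>) B"
  shows "risk_process R N_path X_path" "distr R Ups (X_path n) = \<mu>"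
proof -
  interpret prob_space R by fact
  let ?M = "\<Pi>\<^sub>M n\<in>(UNIV :: nat set). \<mu>"
  let ?x = "\<lambda>x :: path. fst (snd x)"
  have sets_M: "sets ?M = sets Seq"
    by (intro sets_PiM_cong \<mu> refl)
  have spR: "space R = Omega"
    using sets_eq_imp_space_eq[OF R] space_Sig by simp
  have x [measurable]: "?x \<in> measurable R Seq"
    using measurable_fst_snd_Sig by (simp add: measurable_cong_sets[OF R refl])
  \<comment> \<open>The law of the second coordinate comes from \<open>rect\<close> with the whole
    space for \<open>A\<close>.\<close>
  have emeasure_x: "emeasure R (space Seq \<times> B \<times> space Ups) = emeasure ?M B" if "B \<in> sets Seq" for B
    using rect[OF sets.top that] emeasure_space_1 by (simp add: spR Omega_eq)
  have distr_x: "distr R Seq ?x = ?M"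
  proof (rule measure_eqI)
    fix B assume "B \<in> sets (distr R Seq ?x)"
    then have B: "B \<in> sets Seq"
      by simp
    have "?x -` B \<inter> space R = space Seq \<times> B \<times> space Ups"
      using sets.sets_into_space[OF B] by (auto simp: spR Omega_eq)
    with B show "emeasure (distr R Seq ?x) B = emeasure ?M B"
      by (simp add: emeasure_distr[OF x B] emeasure_x)
  qed (simp add: sets_M)
  have X: "X_path n \<in> measurable R Ups" for n
    unfolding X_path_def by (rule measurable_compose[OF x]) simp
  have distr_X: "distr R Ups (X_path n) = \<mu>" for n
  proof -
    have "distr R Ups (X_path n) = distr (distr R Seq ?x) Ups (\<lambda>w. w n)"
      by (subst distr_distr[OF _ x]) (auto simp: X_path_def[abs_def] comp_def)
    also have "\<dots> = distr ?M \<mu> (\<lambda>w. w n)"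
      unfolding distr_x by (intro distr_cong \<mu>[symmetric]) auto
    also have "\<dots> = \<mu>"
      by (intro distr_PiM_component \<open>prob_space \<mu>\<close>) simp
    finally show ?thesis .
  qed
  then show "distr R Ups (X_path n) = \<mu>" .
  have "indep_vars (\<lambda>_. Ups) X_path {1..}"
  proof (subst indep_vars_iff_distr_eq_PiM')
    have "distr R (\<Pi>\<^sub>M i\<in>{1..}. Ups) (\<lambda>x. \<lambda>i\<in>{1..}. X_path i x) =
        distr (distr R Seq ?x) (\<Pi>\<^sub>M i\<in>{1..}. Ups) (\<lambda>w. \<lambda>i\<in>{1..}. w i)"
      by (subst distr_distr[OF _ x]) (auto simp: X_path_def comp_def)
    also have "\<dots> = distr ?M (\<Pi>\<^sub>M i\<in>{1..}. \<mu>) (\<lambda>w. \<lambda>i\<in>{1..}. w i)"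
      unfolding distr_x by (intro distr_cong sets_PiM_cong \<mu>[symmetric]) auto
    \<comment> \<open>Dropping entry 0 of a product measure leaves the product over the remaining
      indices.\<close>
    also have "\<dots> = (\<Pi>\<^sub>M i\<in>{1..}. \<mu>)"
      using distr_PiM_reindex[of UNIV "\<lambda>_. \<mu>" "\<lambda>i. i" "{1..}"] \<open>prob_space \<mu>\<close>
      by (simp del: One_nat_def)
    finally show "distr R (\<Pi>\<^sub>M i\<in>{1..}. Ups) (\<lambda>x. \<lambda>i\<in>{1..}. X_path i x) =
        (\<Pi>\<^sub>M i\<in>{1..}. distr R Ups (X_path i))"
      by (simp only: distr_X)
  qed (simp_all add: X)
  moreover have "indep_set (process_events R {0..} (count_space UNIV) N_path) (process_events R {1..} Ups X_path)"
  proof (rule indep_set_product_rectangles[OF \<open>prob_space R\<close> R _ process_events_N_path[OF R]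
        process_events_X_path[OF R]])
    fix A B assume AB: "A \<in> sets Seq" "B \<in> sets Seq"
    show "emeasure R (A \<times> B \<times> space Ups) =
        emeasure R (A \<times> space Seq \<times> space Ups) * emeasure R (space Seq \<times> B \<times> space Ups)"
      unfolding emeasure_x[OF AB(2)] by (rule rect[OF AB])
  qed
  ultimately show "risk_process R N_path X_path"
    using \<open>prob_space R\<close> counting_process_N_path[OF R fin] X
    by (simp add: risk_process_def size_process_def distr_X)
qed

text \<open>The measure is a Lebesgue integral whose integrand is jointly measurable in the
  parameter and the point.\<close>

lemma measurable_emeasure_Exp_law:
  assumes [measurable]: "h \<in> borel_measurable M" and A: "A \<in> sets Ups"
  shows "(\<lambda>\<theta>. emeasure (Exp_law (h \<theta>)) A) \<in> borel_measurable M"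
proof -
  have [measurable]: "A \<in> sets borel"
    using A unfolding Ups_def by (subst (asm) sets_restrict_space_iff) auto
  have "emeasure (Exp_law (h \<theta>)) A =
      (\<integral>\<^sup>+x. ennreal (h \<theta> * exp (- h \<theta> * x)) * (indicator A x * indicator {0<..} x) \<partial>lborel)" for \<theta>
    using nn_integral_Exp_law[of "indicator A" "h \<theta>"] A by (simp add: sets_Exp_law)
  then show ?thesis
    by simp
qed

section \<open>The mixture of the kernel\<close>

context
  fixes \<mu> \<rho> :: "real measure" and h :: "real \<Rightarrow> real"
  assumes prob_\<mu>: "prob_space \<mu>" and sets_\<mu>: "sets \<mu> = sets Ups"
    and prob_\<rho>: "prob_space \<rho>" and sets_\<rho>: "sets \<rho> = sets Ups"
    and h: "h \<in> borel_measurable Ups" and h_pos: "\<forall>\<theta>\<in>{0<..}. 0 < h \<theta>"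
begin

section \<open>The kernel: measurability and product formulas\<close>

abbreviation (input) "\<mu>_seq \<equiv> \<Pi>\<^sub>M n\<in>(UNIV :: nat set). \<mu>"

lemma space_\<rho>: "space \<rho> = {0<..}"
  using sets_eq_imp_space_eq[OF sets_\<rho>] by (simp add: space_Ups)

lemma sets_\<mu>_seq: "sets \<mu>_seq = sets Seq"
  by (intro sets_PiM_cong sets_\<mu> refl)

lemma prob_space_\<mu>_seq: "prob_space \<mu>_seq"
  by (intro prob_space_PiM prob_\<mu>)

text \<open>Measurability of a kernel may be tested on an intersection-stable generator. On
  finite-dimensional cylinders the measure is a finite product of measurable functions.\<close>

lemma measurable_Exp_seq: "(\<lambda>\<theta>. Exp_seq (h \<theta>)) \<in> measurable \<rho> (prob_algebra Seq)"
proof (rule measurable_prob_algebra_generated[OF sets_PiM Int_stable_prod_algebra prod_algebra_sets_into_space])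
  fix A assume "A \<in> prod_algebra UNIV (\<lambda>_ :: nat. Ups)"
  then obtain J E where A: "A = prod_emb UNIV (\<lambda>_. Ups) J (\<Pi>\<^sub>E j\<in>J. E j)"
    and J: "finite J" and E: "\<And>j. j \<in> J \<Longrightarrow> E j \<in> sets Ups"
    by (auto elim!: prod_algebraE)
  have "emeasure (Exp_seq (h \<theta>)) A = (\<Prod>j\<in>J. emeasure (Exp_law (h \<theta>)) (E j))" if "\<theta> \<in> space \<rho>" for \<theta>
  proof -
    \<comment> \<open>\<open>prod_emb\<close> sees the factors only through their spaces, here the
      half-line in both cases.\<close>
    have "A = prod_emb UNIV (\<lambda>_. Exp_law (h \<theta>)) J (\<Pi>\<^sub>E j\<in>J. E j)"
      unfolding A prod_emb_def by (simp add: space_Exp_law space_Ups)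
    then show ?thesis
      using that h_pos J E by (simp add: emeasure_PiM_emb prob_space_Exp_law space_\<rho> sets_Exp_law)
  qed
  moreover have "(\<lambda>\<theta>. \<Prod>j\<in>J. emeasure (Exp_law (h \<theta>)) (E j)) \<in> borel_measurable \<rho>"
    using h E by (intro borel_measurable_prod_ennreal measurable_emeasure_Exp_law)
      (simp_all add: measurable_cong_sets[OF sets_\<rho> refl])
  ultimately show "(\<lambda>\<theta>. emeasure (Exp_seq (h \<theta>)) A) \<in> borel_measurable \<rho>"
    by (simp cong: measurable_cong)
qed (use h_pos in \<open>auto simp: space_\<rho> sets_Exp_seq intro: prob_space_Exp_seq\<close>)

text \<open>A product of three kernels: exponential sequence, constant and Dirac mass. By
  \<open>sets_Sig\<close> the values are probability measures on \<open>Sig\<close>, so the kernel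
  can be mixed by \<open>bind\<close>.\<close>

lemma measurable_P_kernel: "P_kernel h \<mu> \<in> measurable \<rho> (prob_algebra Sig)"
proof -
  have "\<mu>_seq \<in> space (prob_algebra Seq)"
    by (simp add: space_prob_algebra sets_\<mu>_seq prob_space_\<mu>_seq)
  moreover have "return Ups \<in> measurable \<rho> (prob_algebra Ups)"
    using measurable_return_prob_space by (simp add: measurable_cong_sets[OF sets_\<rho> refl])
  ultimately have "P_kernel h \<mu> \<in> measurable \<rho> (prob_algebra (Seq \<Otimes>\<^sub>M (Seq \<Otimes>\<^sub>M Ups)))"
    unfolding P_kernel_def by (intro measurable_pair_prob measurable_Exp_seq measurable_const)
  also have "prob_algebra (Seq \<Otimes>\<^sub>M (Seq \<Otimes>\<^sub>M Ups)) = prob_algebra Sig"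
    unfolding prob_algebra_def by (simp add: subprob_algebra_cong[OF sets_Sig])
  finally show ?thesis .
qed

lemma prob_space_P_kernel: "0 < \<theta> \<Longrightarrow> prob_space (P_kernel h \<mu> \<theta>)"
  and sets_P_kernel: "0 < \<theta> \<Longrightarrow> sets (P_kernel h \<mu> \<theta>) = sets Sig"
  using measurable_space[OF measurable_P_kernel] by (auto simp: space_prob_algebra space_\<rho>)

lemma space_P_kernel: "0 < \<theta> \<Longrightarrow> space (P_kernel h \<mu> \<theta>) = Omega"
  using sets_eq_imp_space_eq[OF sets_P_kernel] by (simp add: space_Sig)

lemma emeasure_P_kernel_Times:
  assumes \<theta>: "0 < \<theta>" and A: "A \<in> sets Seq" and B: "B \<in> sets Seq" and C: "C \<in> sets Ups"
  shows "emeasure (P_kernel h \<mu> \<theta>) (A \<times> B \<times> C) =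
    emeasure (Exp_seq (h \<theta>)) A * emeasure \<mu>_seq B * indicator C \<theta>"
proof -
  interpret \<delta>: prob_space "return Ups \<theta>"
    using \<theta> by (intro prob_space_return) (simp add: space_Ups)
  interpret M: prob_space \<mu>_seq
    by (rule prob_space_\<mu>_seq)
  interpret M\<delta>: pair_prob_space \<mu>_seq "return Ups \<theta>" ..
  show ?thesis
    using assms unfolding P_kernel_def
    by (simp add: M\<delta>.P.emeasure_pair_measure_Times \<delta>.emeasure_pair_measure_Times
        sets_Exp_seq sets_\<mu>_seq mult.assoc)
qed

lemma emeasure_P_kernel_fst:
  assumes \<theta>: "0 < \<theta>" and A: "A \<in> sets Seq"
  shows "emeasure (P_kernel h \<mu> \<theta>) (A \<times> space Seq \<times> space Ups) = emeasure (Exp_seq (h \<theta>)) A"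
  using emeasure_P_kernel_Times[OF \<theta> A sets.top sets.top] \<theta> prob_space.emeasure_space_1[OF prob_space_\<mu>_seq]
  by (simp add: sets_eq_imp_space_eq[OF sets_\<mu>_seq] space_Ups)

lemma measure_P_kernel_fst:
  assumes \<theta>: "0 < \<theta>" and A: "A \<in> sets Seq"
  shows "measure (P_kernel h \<mu> \<theta>) (fst -` A \<inter> Omega) = measure (Exp_seq (h \<theta>)) A"
proof -
  have "fst -` A \<inter> Omega = A \<times> space Seq \<times> space Ups"
    using sets.sets_into_space[OF A] by (auto simp: Omega_eq)
  then show ?thesis
    using emeasure_P_kernel_fst[OF assms] by (simp add: measure_def)
qed

lemma emeasure_P_kernel_rect:
  assumes \<theta>: "0 < \<theta>" and A: "A \<in> sets Seq" and B: "B \<in> sets Seq"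
  shows "emeasure (P_kernel h \<mu> \<theta>) (A \<times> B \<times> space Ups) =
    emeasure (P_kernel h \<mu> \<theta>) (A \<times> space Seq \<times> space Ups) * emeasure \<mu>_seq B"
  unfolding emeasure_P_kernel_fst[OF \<theta> A] using emeasure_P_kernel_Times[OF assms sets.top] \<theta>
  by (simp add: space_Ups)

lemma emeasure_P_kernel_snd:
  assumes \<theta>: "0 < \<theta>" and B: "B \<in> sets Seq"
  shows "emeasure (P_kernel h \<mu> \<theta>) (space Seq \<times> B \<times> space Ups) = emeasure \<mu>_seq B"
  using emeasure_P_kernel_rect[OF \<theta> sets.top B] prob_space.emeasure_space_1[OF prob_space_P_kernel[OF \<theta>]] \<theta>
  by (simp add: space_P_kernel Omega_eq)

text \<open>The last coordinate is almost surely \<open>\<theta>\<close>, so the condition on it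
  either holds almost surely or excludes everything. This is what identifies the kernel as a
  conditional probability given \<open>proj_Theta\<close>.\<close>

lemma emeasure_P_kernel_Int_Theta:
  assumes \<theta>: "0 < \<theta>" and D: "D \<in> sets Sig" and C: "C \<in> sets Ups"
  shows "emeasure (P_kernel h \<mu> \<theta>) (D \<inter> (proj_Theta -` C \<inter> Omega)) =
    emeasure (P_kernel h \<mu> \<theta>) D * indicator C \<theta>"
proof -
  interpret prob_space "P_kernel h \<mu> \<theta>"
    by (rule prob_space_P_kernel[OF \<theta>])
  let ?C = "proj_Theta -` C \<inter> Omega"
  have C': "?C \<in> events"
    using measurable_sets[OF measurable_proj_Theta C] by (simp add: sets_P_kernel[OF \<theta>] space_Sig)
  have "?C = space Seq \<times> space Seq \<times> C"
    using sets.sets_into_space[OF C] by (auto simp: Omega_eq proj_Theta_eq)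
  then have *: "emeasure (P_kernel h \<mu> \<theta>) ?C = indicator C \<theta>"
    using emeasure_P_kernel_Times[OF \<theta> sets.top sets.top C] \<theta> h_pos
      prob_space.emeasure_space_1[OF prob_space_\<mu>_seq] prob_space.emeasure_space_1[OF prob_space_Exp_seq]
    by (simp add: sets_eq_imp_space_eq[OF sets_\<mu>_seq] sets_eq_imp_space_eq[OF sets_Exp_seq])
  show ?thesis
  proof (cases "\<theta> \<in> C")
    case True
    then have "AE x in P_kernel h \<mu> \<theta>. x \<in> ?C"
      using * C' by (intro AE_prob_1) (simp add: measure_def)
    then have "emeasure (P_kernel h \<mu> \<theta>) (D \<inter> ?C) = emeasure (P_kernel h \<mu> \<theta>) D"
      using D C' by (intro emeasure_eq_AE) (auto simp: sets_P_kernel[OF \<theta>])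
    with True show ?thesis
      by simp
  next
    case False
    have "emeasure (P_kernel h \<mu> \<theta>) (D \<inter> ?C) \<le> emeasure (P_kernel h \<mu> \<theta>) ?C"
      using C' by (intro emeasure_mono) auto
    with False show ?thesis
      by (simp add: *)
  qed
qed

lemma AE_P_kernel_fst:
  assumes \<theta>: "0 < \<theta>"
  shows "AE x in P_kernel h \<mu> \<theta>. cnt (real n) (fst x) \<noteq> \<infinity>"
proof -
  interpret prob_space "P_kernel h \<mu> \<theta>"
    by (rule prob_space_P_kernel[OF \<theta>])
  have l: "0 < h \<theta>"
    using \<theta> h_pos by simp
  let ?A = "{w \<in> space (Exp_seq (h \<theta>)). cnt (real n) w \<in> - {\<infinity>}}"
  have A: "?A \<in> sets Seq"
    using sets_cnt_Exp_seq[of "real n" "h \<theta>" "- {\<infinity>}"] by (simp add: sets_Exp_seq)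
  have "prob (fst -` ?A \<inter> Omega) = measure (Exp_seq (h \<theta>)) ?A"
    by (rule measure_P_kernel_fst[OF \<theta> A])
  also have "\<dots> = 1"
    using AE_cnt_finite[OF l, of "real n"] A
      prob_space.AE_in_set_eq_1[OF prob_space_Exp_seq[OF l], of ?A]
    by (auto simp: sets_Exp_seq elim!: eventually_rev_mp intro: eventually_mono[OF AE_space])
  finally show ?thesis
    by (rule eventually_mono[OF AE_prob_1]) auto
qed

lemma risk_process_P_kernel: "0 < \<theta> \<Longrightarrow> risk_process (P_kernel h \<mu> \<theta>) N_path X_path"
  by (rule risk_process_path[OF prob_space_P_kernel sets_P_kernel prob_\<mu> sets_\<mu>
        AE_P_kernel_fst emeasure_P_kernel_rect])

lemma measurable_emeasure_P_kernel:
  "D \<in> sets Sig \<Longrightarrow> (\<lambda>\<theta>. emeasure (P_kernel h \<mu> \<theta>) D) \<in> borel_measurable \<rho>"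
  by (rule measurable_compose[OF measurable_prob_algebraD[OF measurable_P_kernel]
        measurable_emeasure_subprob_algebra])

lemma measurable_measure_P_kernel:
  "D \<in> sets Sig \<Longrightarrow> (\<lambda>\<theta>. measure (P_kernel h \<mu> \<theta>) D) \<in> borel_measurable \<rho>"
  by (rule measurable_compose[OF measurable_prob_algebraD[OF measurable_P_kernel]
        measurable_measure_subprob_algebra])

section \<open>The mixed measure and its disintegration over \<open>\<rho>\<close>\<close>

definition P_mix :: "path measure" where
  "P_mix = \<rho> \<bind> P_kernel h \<mu>"

lemma \<rho>_in_prob_algebra: "\<rho> \<in> space (prob_algebra \<rho>)"
  by (simp add: space_prob_algebra prob_\<rho>)

lemma prob_space_P_mix: "prob_space P_mix"
  unfolding P_mix_def by (rule prob_space_bind'[OF \<rho>_in_prob_algebra measurable_P_kernel])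

lemma sets_P_mix: "sets P_mix = sets Sig"
  unfolding P_mix_def by (rule sets_bind'[OF \<rho>_in_prob_algebra measurable_P_kernel])

lemma space_P_mix: "space P_mix = Omega"
  using sets_eq_imp_space_eq[OF sets_P_mix] by (simp add: space_Sig)

lemma emeasure_P_mix:
  "D \<in> sets Sig \<Longrightarrow> emeasure P_mix D = (\<integral>\<^sup>+\<theta>. emeasure (P_kernel h \<mu> \<theta>) D \<partial>\<rho>)"
  unfolding P_mix_def by (rule emeasure_bind_prob_algebra[OF \<rho>_in_prob_algebra measurable_P_kernel])

lemma regular_cond_prob_P_mix: "regular_cond_prob (P_kernel h \<mu>) P_mix \<rho>"
  by (auto simp: regular_cond_prob_def space_\<rho> prob_space_P_kernel sets_P_kernel sets_P_mix
      measurable_emeasure_P_kernel emeasure_P_mix)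

lemma measurable_proj_Theta_P_mix: "proj_Theta \<in> measurable P_mix Ups"
  using measurable_proj_Theta by (simp add: measurable_cong_sets[OF sets_P_mix refl])

lemma AE_proj_Theta_pos: "AE x in P_mix. 0 < proj_Theta x"
  using measurable_space[OF measurable_proj_Theta_P_mix] by (intro AE_I2) (simp add: space_Ups)

lemma sets_Theta: "C \<in> sets Ups \<Longrightarrow> proj_Theta -` C \<inter> Omega \<in> sets Sig"
  using measurable_sets[OF measurable_proj_Theta] by (simp add: space_Sig)

lemma emeasure_P_kernel_Theta:
  "0 < \<theta> \<Longrightarrow> C \<in> sets Ups \<Longrightarrow> emeasure (P_kernel h \<mu> \<theta>) (proj_Theta -` C \<inter> Omega) = indicator C \<theta>"
  using emeasure_P_kernel_Int_Theta[OF _ sets.top, of \<theta> C]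
    prob_space.emeasure_space_1[OF prob_space_P_kernel, of \<theta>]
  by (simp add: space_Sig space_P_kernel Int_absorb1)

lemma consistent_with_P_mix: "consistent_with (P_kernel h \<mu>) P_mix \<rho> proj_Theta"
  unfolding consistent_with_def
  by (auto simp: sets_\<rho> space_\<rho> space_P_mix emeasure_P_kernel_Theta intro!: AE_I2)

lemma distr_proj_Theta: "distr P_mix Ups proj_Theta = \<rho>"
proof (rule measure_eqI)
  fix C assume "C \<in> sets (distr P_mix Ups proj_Theta)"
  then have C: "C \<in> sets Ups"
    by simp
  have "emeasure (distr P_mix Ups proj_Theta) C = emeasure P_mix (proj_Theta -` C \<inter> Omega)"
    using emeasure_distr[OF measurable_proj_Theta_P_mix C] by (simp add: space_P_mix)
  also have "\<dots> = (\<integral>\<^sup>+\<theta>. emeasure (P_kernel h \<mu> \<theta>) (proj_Theta -` C \<inter> Omega) \<partial>\<rho>)"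
    by (rule emeasure_P_mix[OF sets_Theta[OF C]])
  also have "\<dots> = (\<integral>\<^sup>+\<theta>. indicator C \<theta> \<partial>\<rho>)"
    by (intro nn_integral_cong) (simp add: space_\<rho> emeasure_P_kernel_Theta C)
  finally show "emeasure (distr P_mix Ups proj_Theta) C = emeasure \<rho> C"
    using C by (simp add: sets_\<rho>)
qed (simp add: sets_\<rho>)

text \<open>The factor from the second coordinate is the same for every \<open>\<theta>\<close> and
  leaves the integral, so the sizes stay independent of the arrivals after mixing.\<close>

lemma emeasure_P_mix_rect:
  assumes A: "A \<in> sets Seq" and B: "B \<in> sets Seq"
  shows "emeasure P_mix (A \<times> B \<times> space Ups) =
    emeasure P_mix (A \<times> space Seq \<times> space Ups) * emeasure (\<Pi>\<^sub>M n\<in>UNIV. \<mu>) B"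
proof -
  have S: "A \<times> C \<times> space Ups \<in> sets Sig" if "C \<in> sets Seq" for C
    unfolding sets_Sig using A that by simp
  have "emeasure P_mix (A \<times> B \<times> space Ups) =
      (\<integral>\<^sup>+\<theta>. emeasure (P_kernel h \<mu> \<theta>) (A \<times> space Seq \<times> space Ups) * emeasure (\<Pi>\<^sub>M n\<in>UNIV. \<mu>) B \<partial>\<rho>)"
    unfolding emeasure_P_mix[OF S[OF B]]
    by (intro nn_integral_cong emeasure_P_kernel_rect A B) (simp add: space_\<rho>)
  also have "\<dots> = (\<integral>\<^sup>+\<theta>. emeasure (P_kernel h \<mu> \<theta>) (A \<times> space Seq \<times> space Ups) \<partial>\<rho>) * emeasure (\<Pi>\<^sub>M n\<in>UNIV. \<mu>) B"
    by (intro nn_integral_multc measurable_emeasure_P_kernel S sets.top)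
  finally show ?thesis
    by (simp add: emeasure_P_mix S)
qed

lemma AE_P_mix_fst: "AE x in P_mix. cnt (real n) (fst x) \<noteq> \<infinity>"
proof -
  have m: "(\<lambda>x. cnt (real n) (fst x)) \<in> measurable Sig (count_space UNIV)"
    by (rule measurable_compose[OF measurable_fst_Sig measurable_cnt]) simp
  have pred: "Measurable.pred Sig (\<lambda>x. cnt (real n) (fst x) \<noteq> \<infinity>)"
    by (rule measurable_compose[OF m]) simp
  show ?thesis
    unfolding P_mix_def AE_bind[OF measurable_prob_algebraD[OF measurable_P_kernel] pred]
    by (rule AE_I2, rule AE_P_kernel_fst) (simp add: space_\<rho>)
qed

lemmas path_facts = prob_space_P_mix sets_P_mix prob_\<mu> sets_\<mu> AE_P_mix_fst emeasure_P_mix_rect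

lemma risk_process_P_mix: "risk_process P_mix N_path X_path"
  by (rule risk_process_path(1)[OF path_facts])

lemma distr_X_P_mix: "distr P_mix Ups (X_path n) = \<mu>"
  by (rule risk_process_path(2)[OF path_facts])

section \<open>Conditioning on the last coordinate\<close>

abbreviation (input) "\<Theta>_algebra \<equiv> vimage_algebra (space P_mix) proj_Theta Ups"

lemma sets_\<Theta>_algebra: "sets \<Theta>_algebra = {proj_Theta -` C \<inter> Omega |C. C \<in> sets Ups}"
  using measurable_space[OF measurable_proj_Theta_P_mix]
  by (subst sets_vimage_algebra2) (auto simp: space_P_mix)

lemma cprob_P_mix:
  assumes D: "D \<in> sets Sig"
  shows "AE x in P_mix. cprob P_mix \<Theta>_algebra D x = measure (P_kernel h \<mu> (proj_Theta x)) D"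
proof -
  interpret prob_space P_mix
    by (rule prob_space_P_mix)
  let ?g = "\<lambda>\<theta>. measure (P_kernel h \<mu> \<theta>) D"
  have "subalgebra P_mix \<Theta>_algebra"
    using sets_Theta by (auto simp: subalgebra_def sets_\<Theta>_algebra sets_P_mix)
  then interpret finite_measure_subalgebra P_mix \<Theta>_algebra
    by unfold_locales
  have g_Ups: "?g \<in> borel_measurable Ups"
    using measurable_measure_P_kernel[OF D] by (simp add: measurable_cong_sets[OF sets_\<rho> refl])
  have g: "(\<lambda>x. ?g (proj_Theta x)) \<in> borel_measurable P_mix"
    by (rule measurable_compose[OF measurable_proj_Theta_P_mix g_Ups])
  have pos: "0 < proj_Theta x" if "x \<in> space P_mix" for x
    using measurable_space[OF measurable_proj_Theta_P_mix that] by (simp add: space_Ups)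
  show ?thesis
    unfolding cprob_def
  proof (rule real_cond_exp_charact)
    show "integrable P_mix (indicator D :: path \<Rightarrow> real)"
      using D by (simp add: sets_P_mix emeasure_eq_measure)
    show "integrable P_mix (\<lambda>x. ?g (proj_Theta x))"
      using g pos by (intro integrable_const_bound[where B = 1])
        (auto intro!: AE_I2 prob_space.prob_le_1 prob_space_P_kernel)
    show "(\<lambda>x. ?g (proj_Theta x)) \<in> borel_measurable \<Theta>_algebra"
      using measurable_space[OF measurable_proj_Theta_P_mix]
      by (intro measurable_compose[OF measurable_vimage_algebra1 g_Ups]) auto
  next
    fix A assume "A \<in> sets \<Theta>_algebra"
    then obtain C where C: "C \<in> sets Ups" and A: "A = proj_Theta -` C \<inter> Omega"
      by (auto simp: sets_\<Theta>_algebra)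
    have DA: "D \<inter> A \<in> sets Sig"
      using D sets_Theta[OF C] A by auto
    have "(\<integral>x\<in>A. indicator D x \<partial>P_mix) = (\<integral>x. indicator (D \<inter> A) x \<partial>P_mix)"
      unfolding set_lebesgue_integral_def by (intro Bochner_Integration.integral_cong) (auto simp: indicator_def)
    also have "\<dots> = enn2real (emeasure P_mix (D \<inter> A))"
      using DA by (simp add: sets_P_mix measure_def)
    also have "\<dots> = enn2real (\<integral>\<^sup>+\<theta>. ennreal (indicator C \<theta> * ?g \<theta>) \<partial>\<rho>)"
    proof -
      have "emeasure (P_kernel h \<mu> \<theta>) (D \<inter> A) = ennreal (indicator C \<theta> * ?g \<theta>)" if "0 < \<theta>" for \<theta>
        using emeasure_P_kernel_Int_Theta[OF that D C] prob_space_P_kernel[OF that]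
        by (simp add: A indicator_def finite_measure.emeasure_eq_measure prob_space_def)
      then show ?thesis
        unfolding emeasure_P_mix[OF DA] by (intro arg_cong[where f = enn2real] nn_integral_cong) (simp add: space_\<rho>)
    qed
    also have "\<dots> = (\<integral>\<theta>. indicator C \<theta> * ?g \<theta> \<partial>\<rho>)"
      using C by (intro integral_eq_nn_integral[symmetric] borel_measurable_times
          borel_measurable_indicator measurable_measure_P_kernel[OF D]) (simp_all add: sets_\<rho>)
    \<comment> \<open>Writing \<open>\<rho>\<close> as the law of \<open>proj_Theta\<close> brings
      the integral back to \<open>P_mix\<close>.\<close>
    also have "\<dots> = (\<integral>\<theta>. indicator C \<theta> * ?g \<theta> \<partial>distr P_mix Ups proj_Theta)"
      by (simp only: distr_proj_Theta)
    also have "\<dots> = (\<integral>x. indicator C (proj_Theta x) * ?g (proj_Theta x) \<partial>P_mix)"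
      using C by (intro integral_distr measurable_proj_Theta_P_mix borel_measurable_times
          borel_measurable_indicator g_Ups)
    also have "\<dots> = (\<integral>x\<in>A. ?g (proj_Theta x) \<partial>P_mix)"
      unfolding set_lebesgue_integral_def
      by (intro Bochner_Integration.integral_cong) (auto simp: indicator_def A space_P_mix)
    finally show "(\<integral>x\<in>A. indicator D x \<partial>P_mix) = (\<integral>x\<in>A. ?g (proj_Theta x) \<partial>P_mix)" .
  qed
qed

text \<open>By \<open>cprob_P_mix\<close> the product rule under
  \<open>P_kernel h \<mu> \<theta>\<close> may be read at \<open>\<theta> = proj_Theta x\<close>.
  Only finitely many events are involved, so their null sets unite to one.\<close>

lemma cond_indep_sets_P_mix:
  assumes indep: "\<And>\<theta>. 0 < \<theta> \<Longrightarrow> prob_space.indep_sets (P_kernel h \<mu> \<theta>) G I"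
  shows "cond_indep_sets P_mix \<Theta>_algebra G I"
  unfolding cond_indep_sets_def
proof (intro conjI allI impI ballI)
  \<comment> \<open>Independence at one arbitrary parameter, here 1, already gives measurability of
    the events.\<close>
  have G: "G i \<subseteq> sets Sig" if "i \<in> I" for i
    using indep[of 1] that prob_space.indep_sets_def[OF prob_space_P_kernel, of 1 G I]
    by (simp add: sets_P_kernel)
  then show "G i \<subseteq> sets P_mix" if "i \<in> I" for i
    using that by (simp add: sets_P_mix)
  fix J A assume J: "J \<subseteq> I" "J \<noteq> {}" "finite J" and A: "A \<in> Pi J G"
  have AS: "A j \<in> sets Sig" if "j \<in> J" for j
    using that J A G by blast
  have "AE x in P_mix. \<forall>j\<in>J. cprob P_mix \<Theta>_algebra (A j) x = measure (P_kernel h \<mu> (proj_Theta x)) (A j)"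
    using J AS by (intro AE_finite_allI cprob_P_mix)
  moreover have "(\<Inter>j\<in>J. A j) \<in> sets Sig"
    using J AS by (intro sets.finite_INT)
  note cprob_P_mix[OF this]
  ultimately show "AE x in P_mix. cprob P_mix \<Theta>_algebra (\<Inter>j\<in>J. A j) x = (\<Prod>j\<in>J. cprob P_mix \<Theta>_algebra (A j) x)"
    using AE_proj_Theta_pos
  proof eventually_elim
    case (elim x)
    then have "measure (P_kernel h \<mu> (proj_Theta x)) (\<Inter>j\<in>J. A j) =
        (\<Prod>j\<in>J. measure (P_kernel h \<mu> (proj_Theta x)) (A j))"
      using J A by (intro prob_space.indep_setsD[OF prob_space_P_kernel indep]) auto
    with elim show ?case
      by simp
  qed
qed

lemma cond_indep_interarrival_X:
  "cond_indep_set P_mix \<Theta>_algebra (process_events P_mix {1..} borel (interarrival N_path))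
    (process_events P_mix {1..} Ups X_path)"
  unfolding cond_indep_set_def
proof (rule cond_indep_sets_P_mix)
  fix \<theta> :: real assume \<theta>: "0 < \<theta>"
  \<comment> \<open>\<open>process_events\<close> depends on the measure only through its space, so
    the events agree for the kernel and the mixture.\<close>
  have sp: "space P_mix = space (P_kernel h \<mu> \<theta>)"
    by (simp add: space_P_mix space_P_kernel[OF \<theta>])
  have "prob_space.indep_set (P_kernel h \<mu> \<theta>)
      (process_events (P_kernel h \<mu> \<theta>) {1..} borel (interarrival N_path))
      (process_events (P_kernel h \<mu> \<theta>) {1..} Ups X_path)"
  proof (rule indep_set_product_rectangles[OF prob_space_P_kernel[OF \<theta>] sets_P_kernel[OF \<theta>] _
        process_events_interarrival_N_path[OF sets_P_kernel[OF \<theta>]]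
        process_events_X_path[OF sets_P_kernel[OF \<theta>]]])
    fix A B assume AB: "A \<in> sets Seq" "B \<in> sets Seq"
    show "emeasure (P_kernel h \<mu> \<theta>) (A \<times> B \<times> space Ups) =
        emeasure (P_kernel h \<mu> \<theta>) (A \<times> space Seq \<times> space Ups) *
        emeasure (P_kernel h \<mu> \<theta>) (space Seq \<times> B \<times> space Ups)"
      unfolding emeasure_P_kernel_snd[OF \<theta> AB(2)] by (rule emeasure_P_kernel_rect[OF \<theta> AB])
  qed
  then show "prob_space.indep_sets (P_kernel h \<mu> \<theta>)
      (case_bool (process_events P_mix {1..} borel (interarrival N_path)) (process_events P_mix {1..} Ups X_path)) UNIV"
    unfolding prob_space.indep_set_def[OF prob_space_P_kernel[OF \<theta>]] process_events_cong_space[OF sp] .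
qed

text \<open>The probability of a size event under the kernel does not depend on
  \<open>\<theta>\<close>; it leaves the integral over \<open>C\<close>, and \<open>\<rho> C\<close>
  remains.\<close>

lemma indep_Theta_X:
  "prob_space.indep_set P_mix (sets \<Theta>_algebra) (process_events P_mix {1..} Ups X_path)"
proof -
  interpret prob_space P_mix
    by (rule prob_space_P_mix)
  show ?thesis
  proof (rule indep_setI)
    show "sets \<Theta>_algebra \<subseteq> events"
      using sets_Theta by (auto simp: sets_\<Theta>_algebra sets_P_mix)
    have X: "process_events P_mix {1..} Ups X_path \<subseteq> {(\<lambda>x. fst (snd x)) -` A \<inter> Omega |A. A \<in> sets Seq}"
      using process_events_X_path[OF sets_P_mix] by (simp only: space_P_mix)
    also have "\<dots> \<subseteq> events"
      using measurable_sets[OF measurable_fst_snd_Sig] by (auto simp: sets_P_mix space_Sig)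
    finally show "process_events P_mix {1..} Ups X_path \<subseteq> events" .
    fix a b assume "a \<in> sets \<Theta>_algebra" "b \<in> process_events P_mix {1..} Ups X_path"
    obtain C where C: "C \<in> sets Ups" and a: "a = proj_Theta -` C \<inter> Omega"
      using \<open>a \<in> sets \<Theta>_algebra\<close> by (auto simp: sets_\<Theta>_algebra)
    obtain B where B: "B \<in> sets Seq" and "b = (\<lambda>x. fst (snd x)) -` B \<inter> Omega"
      using subsetD[OF X \<open>b \<in> _\<close>] by blast
    then have b: "b = space Seq \<times> B \<times> space Ups"
      using sets.sets_into_space[OF B] by (auto simp: Omega_eq)
    have bS: "b \<in> sets Sig"
      using B by (simp add: b sets_Sig)
    have Kb: "emeasure (P_kernel h \<mu> \<theta>) b = emeasure (\<Pi>\<^sub>M n\<in>UNIV. \<mu>) B" if "0 < \<theta>" for \<theta>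
      unfolding b by (rule emeasure_P_kernel_snd[OF that B])
    have "emeasure P_mix (a \<inter> b) = (\<integral>\<^sup>+\<theta>. emeasure (\<Pi>\<^sub>M n\<in>UNIV. \<mu>) B * indicator C \<theta> \<partial>\<rho>)"
      using bS sets_Theta[OF C] emeasure_P_kernel_Int_Theta[OF _ bS C] Kb
      by (subst emeasure_P_mix) (auto simp: a Int_commute space_\<rho> intro!: nn_integral_cong)
    also have "\<dots> = emeasure (\<Pi>\<^sub>M n\<in>UNIV. \<mu>) B * emeasure \<rho> C"
      using C by (subst nn_integral_cmult_indicator) (simp_all add: sets_\<rho>)
    also have "emeasure \<rho> C = emeasure P_mix a"
      using emeasure_distr[OF measurable_proj_Theta_P_mix C] by (simp add: distr_proj_Theta a space_P_mix)
    also have "emeasure (\<Pi>\<^sub>M n\<in>UNIV. \<mu>) B = emeasure P_mix b"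
      using emeasure_P_mix_rect[OF sets.top B] emeasure_space_1
      by (simp add: b space_P_mix Omega_eq)
    finally show "prob (a \<inter> b) = prob a * prob b"
      by (simp add: measure_def enn2real_mult mult.commute)
  qed
qed

section \<open>Conditional law of the arrivals and their increments\<close>

lemma indep_sets_P_kernel_fst:
  assumes \<theta>: "0 < \<theta>" and indep: "prob_space.indep_sets (Exp_seq (h \<theta>)) G I"
  shows "prob_space.indep_sets (P_kernel h \<mu> \<theta>) (\<lambda>i. {fst -` A \<inter> Omega |A. A \<in> G i}) I"
proof -
  interpret prob_space "P_kernel h \<mu> \<theta>"
    by (rule prob_space_P_kernel[OF \<theta>])
  have E: "prob_space (Exp_seq (h \<theta>))"
    using h_pos \<theta> by (intro prob_space_Exp_seq) simp
  have G: "G i \<subseteq> sets Seq" if "i \<in> I" for i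
    using indep that unfolding prob_space.indep_sets_def[OF E] by (simp add: sets_Exp_seq)
  show ?thesis
  proof (rule indep_setsI)
    show "{fst -` A \<inter> Omega |A. A \<in> G i} \<subseteq> events" if "i \<in> I" for i
      using G[OF that] measurable_sets[OF measurable_fst_Sig]
      by (auto simp: sets_P_kernel[OF \<theta>] space_Sig)
  next
    fix A J assume J: "J \<noteq> {}" "J \<subseteq> I" "finite J"
      and "\<forall>j\<in>J. A j \<in> {fst -` A \<inter> Omega |A. A \<in> G j}"
    then have "\<forall>j\<in>J. \<exists>B. A j = fst -` B \<inter> Omega \<and> B \<in> G j"
      by blast
    then obtain B where B: "\<And>j. j \<in> J \<Longrightarrow> A j = fst -` B j \<inter> Omega" "\<And>j. j \<in> J \<Longrightarrow> B j \<in> G j"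
      by metis
    then have BS: "B j \<in> sets Seq" if "j \<in> J" for j
      using that G J by blast
    have "prob (\<Inter>j\<in>J. A j) = prob (fst -` (\<Inter>j\<in>J. B j) \<inter> Omega)"
      using J B by (intro arg_cong[where f = prob]) auto
    \<comment> \<open>Under the kernel the first coordinate has the law
      \<open>Exp_seq (h \<theta>)\<close>.\<close>
    also have "\<dots> = measure (Exp_seq (h \<theta>)) (\<Inter>j\<in>J. B j)"
      using J BS by (intro measure_P_kernel_fst[OF \<theta>] sets.finite_INT)
    also have "\<dots> = (\<Prod>j\<in>J. measure (Exp_seq (h \<theta>)) (B j))"
      using J B by (intro prob_space.indep_setsD[OF E indep]) auto
    also have "\<dots> = (\<Prod>j\<in>J. prob (A j))"
      using B BS by (intro prod.cong) (simp_all add: measure_P_kernel_fst[OF \<theta>])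
    finally show "prob (\<Inter>j\<in>J. A j) = (\<Prod>j\<in>J. prob (A j))" .
  qed
qed

lemma cprob_P_mix_fst:
  assumes A: "{w \<in> space Seq. Q w} \<in> sets Seq"
  shows "AE x in P_mix. cprob P_mix \<Theta>_algebra {x \<in> Omega. Q (fst x)} x =
    measure (Exp_seq (h (proj_Theta x))) {w \<in> space Seq. Q w}"
proof -
  have eq: "{x \<in> Omega. Q (fst x)} = fst -` {w \<in> space Seq. Q w} \<inter> Omega"
    by (auto simp: Omega_eq)
  have "fst -` {w \<in> space Seq. Q w} \<inter> Omega \<in> sets Sig"
    using measurable_sets[OF measurable_fst_Sig A] by (simp add: space_Sig)
  from cprob_P_mix[OF this] AE_proj_Theta_pos show ?thesis
    unfolding eq
  proof eventually_elim
    case (elim x)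
    from elim(1) measure_P_kernel_fst[OF elim(2) A] show ?case
      by (rule trans)
  qed
qed

lemma space_Exp_seq_eq: "space (Exp_seq l) = space Seq"
  by (rule sets_eq_imp_space_eq[OF sets_Exp_seq])

text \<open>The right-hand side depends on the times only through \<open>t - s\<close>, which makes
  the conditional increments stationary.\<close>

lemma cprob_increment:
  assumes "0 \<le> s" "s \<le> t"
  shows "AE x in P_mix. cprob P_mix \<Theta>_algebra ((\<lambda>x. N_path t x - N_path s x) -` B \<inter> space P_mix) x =
    measure (Exp_seq (h (proj_Theta x))) {w \<in> space Seq. cnt (t - s) w \<in> B}"
proof -
  have "(\<lambda>x. N_path t x - N_path s x) -` B \<inter> space P_mix = {x \<in> Omega. cnt t (fst x) - cnt s (fst x) \<in> B}"
    by (auto simp: N_path_def space_P_mix)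
  then show ?thesis
    using cprob_P_mix_fst[OF sets_cnt_diff[of t s B]] assms AE_proj_Theta_pos
    by (auto elim!: eventually_elim2
        simp: measure_def emeasure_cnt_diff[unfolded space_Exp_seq_eq] h_pos[rule_format])
qed

lemma cond_stationary_indep_increments_P_mix:
  "cond_stationary_indep_increments P_mix \<Theta>_algebra N_path"
  unfolding cond_stationary_indep_increments_def
proof (intro conjI allI impI)
  fix m and t :: "nat \<Rightarrow> real" assume t: "0 \<le> t 0" "\<forall>j<m. t j < t (Suc j)"
  show "cond_indep_sets P_mix \<Theta>_algebra
      (\<lambda>j. {(\<lambda>x. N_path (t (Suc j)) x - N_path (t j) x) -` B \<inter> space P_mix |B. True}) {..<m}"
  proof (rule cond_indep_sets_P_mix)
    fix \<theta> :: real assume \<theta>: "0 < \<theta>"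
    have l: "0 < h \<theta>"
      using h_pos \<theta> by simp
    \<comment> \<open>Increment events are preimages of events of the interarrival sequence, to
      which independence is transferred.\<close>
    have "{(\<lambda>x. N_path (t (Suc j)) x - N_path (t j) x) -` B \<inter> space P_mix |B. True} =
        {fst -` A \<inter> Omega |A. A \<in> {{w \<in> space (Exp_seq (h \<theta>)). cnt (t (Suc j)) w - cnt (t j) w \<in> B} |B. True}}" for j
    proof -
      have eq: "(\<lambda>x. N_path (t (Suc j)) x - N_path (t j) x) -` B \<inter> space P_mix =
          fst -` {w \<in> space (Exp_seq (h \<theta>)). cnt (t (Suc j)) w - cnt (t j) w \<in> B} \<inter> Omega" for B
        by (auto simp: N_path_def space_P_mix Omega_eq space_Exp_seq_eq)
      show ?thesis
        unfolding eq by blast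
    qed
    moreover have "prob_space.indep_sets (Exp_seq (h \<theta>))
        (\<lambda>j. {{w \<in> space (Exp_seq (h \<theta>)). cnt (t (Suc j)) w - cnt (t j) w \<in> B} |B. True}) {..<m}"
      using t by (intro indep_sets_cnt_diff l) (simp_all add: less_imp_le)
    note indep_sets_P_kernel_fst[OF \<theta> this]
    ultimately show "prob_space.indep_sets (P_kernel h \<mu> \<theta>)
        (\<lambda>j. {(\<lambda>x. N_path (t (Suc j)) x - N_path (t j) x) -` B \<inter> space P_mix |B. True}) {..<m}"
      by (simp only:)
  qed
next
  fix s t u :: real and B assume *: "0 \<le> s" "s < t" "0 \<le> u"
  then have "0 \<le> s + u" "s + u \<le> t + u"
    by simp_all
  from cprob_increment[OF this, of B] cprob_increment[OF *(1) less_imp_le[OF *(2)], of B]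
  show "AE x in P_mix.
      cprob P_mix \<Theta>_algebra ((\<lambda>x. N_path (t + u) x - N_path (s + u) x) -` B \<inter> space P_mix) x =
      cprob P_mix \<Theta>_algebra ((\<lambda>x. N_path t x - N_path s x) -` B \<inter> space P_mix) x"
    by eventually_elim simp
qed

lemma cprob_N_path:
  assumes t: "0 < t"
  shows "AE x in P_mix. cprob P_mix \<Theta>_algebra (N_path t -` B \<inter> space P_mix) x =
    measure_pmf.prob (poisson_pmf (t * h (proj_Theta x))) (enat -` B)"
proof -
  note cprob_P_mix_fst[OF sets_cnt[OF less_imp_le[OF t], of B]]
  moreover have "N_path t -` B \<inter> space P_mix = {x \<in> Omega. cnt t (fst x) \<in> B}"
    by (auto simp: N_path_def space_P_mix)
  ultimately show ?thesis
    using AE_proj_Theta_pos t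
    by (auto elim!: eventually_elim2
        simp: measure_def emeasure_cnt_poisson[unfolded space_Exp_seq_eq] h_pos[rule_format])
qed

lemma CMPP_P_mix: "CMPP P_mix h proj_Theta \<mu> N_path X_path (aggregate N_path X_path)"
  unfolding CMPP_def
  by (intro conjI allI impI ballI refl measurable_proj_Theta_P_mix risk_process_P_mix distr_X_P_mix
      cond_stationary_indep_increments_P_mix cprob_N_path)

end

theorem proposition4p1:
  fixes \<mu> \<rho> :: "real measure" and h :: "real \<Rightarrow> real"
  assumes "prob_space \<mu>" and "sets \<mu> = sets Ups"
    and "prob_space \<rho>" and "sets \<rho> = sets Ups"
    and "h \<in> borel_measurable Ups" and "\<forall>\<theta>\<in>{0<..}. h \<theta> > 0"
  shows "\<exists>(PP :: real \<Rightarrow> path measure) (P :: path measure).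
    (\<forall>\<theta>\<in>{0<..}. PP \<theta> = P_kernel h \<mu> \<theta> \<and> prob_space (PP \<theta>) \<and> sets (PP \<theta>) = sets Sig) \<and>
    prob_space P \<and> sets P = sets Sig \<and>
    regular_cond_prob PP P \<rho> \<and>
    proj_Theta \<in> measurable P Ups \<and> distr P Ups proj_Theta = \<rho> \<and>
    consistent_with PP P \<rho> proj_Theta \<and>
    (\<exists>(N :: real \<Rightarrow> path \<Rightarrow> enat) (X :: nat \<Rightarrow> path \<Rightarrow> real).
      counting_process P N \<and> size_process P X \<and>
      distr P Ups (X 1) = \<mu> \<and>
      cond_indep_set P (vimage_algebra (space P) proj_Theta Ups)
        (process_events P {1..} borel (interarrival N)) (process_events P {1..} Ups X) \<and>
      prob_space.indep_set P
        (sets (vimage_algebra (space P) proj_Theta Ups)) (process_events P {1..} Ups X) \<and>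
      risk_process P N X \<and>
      (\<forall>\<theta>\<in>{0<..}. risk_process (PP \<theta>) N X) \<and>
      CMPP P h proj_Theta \<mu> N X (aggregate N X))"
proof -
  \<comment> \<open>Outside the context \<open>P_mix\<close> takes \<open>\<mu>\<close>,
    \<open>\<rho>\<close> and \<open>h\<close> as arguments, and the context's assumptions are those
    of the theorem.\<close>
  have "counting_process (P_mix \<mu> \<rho> h) N_path" "size_process (P_mix \<mu> \<rho> h) X_path"
    using risk_process_P_mix[OF assms] by (simp_all add: risk_process_def)
  then show ?thesis
    by (intro exI[of _ "P_kernel h \<mu>"] exI[of _ "P_mix \<mu> \<rho> h"] exI[of _ N_path] exI[of _ X_path]
        conjI ballI refl prob_space_P_kernel[OF assms] sets_P_kernel[OF assms]
        prob_space_P_mix[OF assms] sets_P_mix[OF assms] regular_cond_prob_P_mix[OF assms]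
        measurable_proj_Theta_P_mix[OF assms] distr_proj_Theta[OF assms]
        consistent_with_P_mix[OF assms] distr_X_P_mix[OF assms] cond_indep_interarrival_X[OF assms]
        indep_Theta_X[OF assms] risk_process_P_mix[OF assms] risk_process_P_kernel[OF assms]
        CMPP_P_mix[OF assms]) simp_all
qed

end
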